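(* Let $k$ be a perfect field of characteristic $p=2$. Set $R=k[[x,y]]$ and $S=R[t]/(t^p-x)\cong k[[t,y]]$, where the homomorphism $R\to S$ is given by $x\mapsto t^p$, $y\mapsto y$. Let $P=(y^p-x^{p+1})\subset R$. Then $S$ is finite free of rank $p$ as an $R$-module, $P$ is a prime ideal of $R$, $S/\sqrt{PS}$ is a regular local ring, and: (1) $R/P$ is not $F$-pure; (2) $R/P$ is not $F$-injective; (3) $R/P$ is not $F$-rational.
   Context: For a noetherian local ring $(A,\mathfrak m)$ of prime characteristic $p$ with Frobenius $F$: $A$ is $F$-pure if $F:A\to F_*A$ is a pure map of $A$-modules; $A$ is $F$-injective if the Frobenius action on $H^i_{\mathfrak m}(A)$ is injective for every $i$; $A$ is $F$-rational if every ideal generated by a (partial) system of parameters is tightly closed. $PS$ is the ideal of $S$ generated by the image of $P$ and $\sqrt{PS}$ is its radical. *)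

theory Defs
  imports
    "HOL-Algebra.Algebra"
    "HOL-Algebra.Algebraic_Closure_Type"
    "HOL-Computational_Algebra.Formal_Power_Series"
    "HOL-Library.Extended_Nat"
begin

subsection \<open>Local rings, dimension, regularity\<close>

definition perfect_field :: "'k::field itself \<Rightarrow> bool" where
  "perfect_field _ \<longleftrightarrow> CHAR('k) = 0 \<or> surj (\<lambda>a::'k. a ^ CHAR('k))"

definition local_ring :: "('a, 'b) ring_scheme \<Rightarrow> bool" where
  "local_ring A \<longleftrightarrow> cring A \<and> (\<exists>!M. maximalideal M A)"

definition max_ideal :: "('a, 'b) ring_scheme \<Rightarrow> 'a set" where
  "max_ideal A = (THE M. maximalideal M A)"

definition ideal_radical :: "('a, 'b) ring_scheme \<Rightarrow> 'a set \<Rightarrow> 'a set" where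
  "ideal_radical A I = {a \<in> carrier A. \<exists>n::nat. a [^]\<^bsub>A\<^esub> n \<in> I}"

definition krull_dim :: "('a, 'b) ring_scheme \<Rightarrow> enat" where
  "krull_dim A = Sup {enat n | n. \<exists>C :: nat \<Rightarrow> 'a set.
      (\<forall>i\<le>n. primeideal (C i) A) \<and> (\<forall>i<n. C i \<subset> C (Suc i))}"

definition embedding_dim :: "('a, 'b) ring_scheme \<Rightarrow> nat" where
  "embedding_dim A = (LEAST n. \<exists>G. G \<subseteq> carrier A \<and> finite G \<and> card G = n \<and> Idl\<^bsub>A\<^esub> G = max_ideal A)"

definition regular_local_ring :: "('a, 'b) ring_scheme \<Rightarrow> bool" where
  "regular_local_ring A \<longleftrightarrow>
     noetherian_ring A \<and> local_ring A \<and> enat (embedding_dim A) = krull_dim A"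

subsection \<open>Modules and purity\<close>

text \<open>The ring \<open>B\<close> as an \<open>A\<close>-module along a ring homomorphism \<open>f\<close> from \<open>A\<close> to \<open>B\<close>.\<close>

definition module_along :: "('a \<Rightarrow> 'b) \<Rightarrow> ('b, 'c) ring_scheme \<Rightarrow> ('a, 'b) module" where
  "module_along f B = \<lparr>carrier = carrier B, monoid.mult = monoid.mult B, one = one B, ring.zero = ring.zero B,
     add = add B,
     module.smult = (\<lambda>a b. f a \<otimes>\<^bsub>B\<^esub> b)\<rparr>"

definition free_of_rank :: "('a, 'b) ring_scheme \<Rightarrow> ('a, 'm, 'c) module_scheme \<Rightarrow> nat \<Rightarrow> bool" where
  "free_of_rank A M n \<longleftrightarrow> module A M \<and>
     (\<exists>b \<in> {..<n} \<rightarrow> carrier M. \<forall>m \<in> carrier M.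
        \<exists>!r. r \<in> {..<n} \<rightarrow>\<^sub>E carrier A \<and> m = (\<Oplus>\<^bsub>M\<^esub>i\<in>{..<n}. r i \<odot>\<^bsub>M\<^esub> b i))"

definition tensor_relators ::
    "('a, 'b) ring_scheme \<Rightarrow> ('a, 'm, 'c) module_scheme \<Rightarrow> ('a, 'n, 'd) module_scheme
      \<Rightarrow> ('m \<times> 'n \<Rightarrow>\<^sub>0 int) set" where
  "tensor_relators A M N =
     {frag_of (x \<oplus>\<^bsub>M\<^esub> x', y) - frag_of (x, y) - frag_of (x', y) | x x' y.
        x \<in> carrier M \<and> x' \<in> carrier M \<and> y \<in> carrier N} \<union>
     {frag_of (x, y \<oplus>\<^bsub>N\<^esub> y') - frag_of (x, y) - frag_of (x, y') | x y y'.
        x \<in> carrier M \<and> y \<in> carrier N \<and> y' \<in> carrier N} \<union>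
     {frag_of (a \<odot>\<^bsub>M\<^esub> x, y) - frag_of (x, a \<odot>\<^bsub>N\<^esub> y) | a x y.
        a \<in> carrier A \<and> x \<in> carrier M \<and> y \<in> carrier N}"

definition tensor_kernel ::
    "('a, 'b) ring_scheme \<Rightarrow> ('a, 'm, 'c) module_scheme \<Rightarrow> ('a, 'n, 'd) module_scheme
      \<Rightarrow> ('m \<times> 'n \<Rightarrow>\<^sub>0 int) set" where
  "tensor_kernel A M N =
     generate (free_Abelian_group (carrier M \<times> carrier N)) (tensor_relators A M N)"

definition tensor_product ::
    "('a, 'b) ring_scheme \<Rightarrow> ('a, 'm, 'c) module_scheme \<Rightarrow> ('a, 'n, 'd) module_scheme
      \<Rightarrow> ('m \<times> 'n \<Rightarrow>\<^sub>0 int) set monoid" where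
  "tensor_product A M N = free_Abelian_group (carrier M \<times> carrier N) Mod tensor_kernel A M N"

text \<open>The map \<open>id \<otimes> f\<close> from \<open>M \<otimes> N\<close> to \<open>M \<otimes> N'\<close>; the union is over representatives of a coset and
  all of them yield the same coset.\<close>

definition tensor_map ::
    "('a, 'b) ring_scheme \<Rightarrow> ('a, 'm, 'c) module_scheme \<Rightarrow> ('a, 'n, 'd) module_scheme
      \<Rightarrow> ('n0 \<Rightarrow> 'n) \<Rightarrow> ('m \<times> 'n0 \<Rightarrow>\<^sub>0 int) set \<Rightarrow> ('m \<times> 'n \<Rightarrow>\<^sub>0 int) set" where
  "tensor_map A M N' f C =
     (\<Union>z\<in>C. r_coset (free_Abelian_group (carrier M \<times> carrier N')) (tensor_kernel A M N')
        (frag_extend (\<lambda>(x, y). frag_of (x, f y)) z))"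

text \<open>Purity of the \<open>A\<close>-linear map \<open>f\<close> from \<open>N\<close> to \<open>N'\<close>, tested on the modules \<open>M\<close> whose elements
  have type \<open>'m\<close>.\<close>

definition pure_map ::
    "'m itself \<Rightarrow> ('a, 'b) ring_scheme \<Rightarrow> ('a, 'n0, 'c) module_scheme \<Rightarrow> ('a, 'n, 'd) module_scheme
      \<Rightarrow> ('n0 \<Rightarrow> 'n) \<Rightarrow> bool" where
  "pure_map _ A N N' f \<longleftrightarrow>
     (\<forall>M :: ('a, 'm) module. module A M \<longrightarrow>
        inj_on (tensor_map A M N' f) (carrier (tensor_product A M N)))"

definition frobenius :: "nat \<Rightarrow> ('a, 'b) ring_scheme \<Rightarrow> 'a \<Rightarrow> 'a" where
  "frobenius p A a = a [^]\<^bsub>A\<^esub> p"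

text \<open>The notions below are meant for a noetherian local ring \<open>A\<close> of characteristic \<open>p\<close>; no such
  condition is built into them.\<close>

text \<open>The module type \<open>(nat \<Rightarrow> 'a) set\<close> accommodates every quotient of every \<open>A\<^sup>n\<close>, as a set of
  cosets, so up to isomorphism every finitely presented \<open>A\<close>-module is tested. Since each module is a
  filtered colimit of finitely presented ones and tensor products commute with filtered colimits,
  this is purity with respect to all modules, of any size.\<close>

definition F_pure :: "nat \<Rightarrow> ('a, 'b) ring_scheme \<Rightarrow> bool" where
  "F_pure p A \<longleftrightarrow>
     pure_map TYPE((nat \<Rightarrow> 'a) set) A (module_along (\<lambda>a. a) A) (module_along (frobenius p A) A)
       (frobenius p A)"

subsection \<open>Localization and local cohomology\<close>

definition loc_rel :: "('a, 'b) ring_scheme \<Rightarrow> 'a set \<Rightarrow> (('a \<times> 'a) \<times> ('a \<times> 'a)) set" where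
  "loc_rel A W = {((a, s), (b, t)). a \<in> carrier A \<and> s \<in> W \<and> b \<in> carrier A \<and> t \<in> W \<and>
     (\<exists>u\<in>W. u \<otimes>\<^bsub>A\<^esub> (t \<otimes>\<^bsub>A\<^esub> a) = u \<otimes>\<^bsub>A\<^esub> (s \<otimes>\<^bsub>A\<^esub> b))}"

definition fraction :: "('a, 'b) ring_scheme \<Rightarrow> 'a set \<Rightarrow> 'a \<Rightarrow> 'a \<Rightarrow> ('a \<times> 'a) set" where
  "fraction A W a s = loc_rel A W `` {(a, s)}"

definition localization :: "('a, 'b) ring_scheme \<Rightarrow> 'a set \<Rightarrow> ('a \<times> 'a) set ring" where
  "localization A W =
     \<lparr>carrier = (carrier A \<times> W) // loc_rel A W,
      monoid.mult = (\<lambda>C D. \<Union>(a, s)\<in>C. \<Union>(b, t)\<in>D. fraction A W (a \<otimes>\<^bsub>A\<^esub> b) (s \<otimes>\<^bsub>A\<^esub> t)),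
      one = fraction A W \<one>\<^bsub>A\<^esub> \<one>\<^bsub>A\<^esub>,
      ring.zero = fraction A W \<zero>\<^bsub>A\<^esub> \<one>\<^bsub>A\<^esub>,
      add = (\<lambda>C D. \<Union>(a, s)\<in>C. \<Union>(b, t)\<in>D.
               fraction A W ((t \<otimes>\<^bsub>A\<^esub> a) \<oplus>\<^bsub>A\<^esub> (s \<otimes>\<^bsub>A\<^esub> b)) (s \<otimes>\<^bsub>A\<^esub> t))\<rparr>"

text \<open>The canonical map to the localization at a larger multiplicative set \<open>W'\<close>.\<close>

definition loc_map :: "('a, 'b) ring_scheme \<Rightarrow> 'a set \<Rightarrow> ('a \<times> 'a) set \<Rightarrow> ('a \<times> 'a) set" where
  "loc_map A W' C = (\<Union>(a, s)\<in>C. fraction A W' a s)"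

text \<open>The Cech complex of \<open>A\<close> on a list \<open>xs\<close>. In degree \<open>i\<close> it is the product, over the \<open>i\<close>-element
  sets \<open>J\<close> of positions of \<open>xs\<close>, of the localization of \<open>A\<close> at the multiplicative set generated by
  the entries at positions in \<open>J\<close> (equivalently, at the powers of their product).\<close>

definition cech_index :: "'a list \<Rightarrow> nat \<Rightarrow> nat set set" where
  "cech_index xs i = {J. J \<subseteq> {..<length xs} \<and> card J = i}"

definition cech_loc :: "('a, 'b) ring_scheme \<Rightarrow> 'a list \<Rightarrow> nat set \<Rightarrow> 'a set" where
  "cech_loc A xs J = range (\<lambda>e :: nat \<Rightarrow> nat. \<Otimes>\<^bsub>A\<^esub>j\<in>J. (xs ! j) [^]\<^bsub>A\<^esub> e j)"

definition cech_cochains ::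
    "('a, 'b) ring_scheme \<Rightarrow> 'a list \<Rightarrow> nat \<Rightarrow> (nat set \<Rightarrow> ('a \<times> 'a) set) monoid" where
  "cech_cochains A xs i =
     product_group (cech_index xs i) (\<lambda>J. add_monoid (localization A (cech_loc A xs J)))"

definition cech_diff ::
    "('a, 'b) ring_scheme \<Rightarrow> 'a list \<Rightarrow> nat
      \<Rightarrow> (nat set \<Rightarrow> ('a \<times> 'a) set) \<Rightarrow> (nat set \<Rightarrow> ('a \<times> 'a) set)" where
  "cech_diff A xs i c = (\<lambda>J \<in> cech_index xs (Suc i).
     let L = localization A (cech_loc A xs J) in
     \<Oplus>\<^bsub>L\<^esub>j\<in>J. add_pow L ((-1 :: int) ^ card {l \<in> J. l < j}) (loc_map A (cech_loc A xs J) (c (J - {j}))))"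

definition cech_cocycles ::
    "('a, 'b) ring_scheme \<Rightarrow> 'a list \<Rightarrow> nat \<Rightarrow> (nat set \<Rightarrow> ('a \<times> 'a) set) set" where
  "cech_cocycles A xs i =
     kernel (cech_cochains A xs i) (cech_cochains A xs (Suc i)) (cech_diff A xs i)"

definition cech_coboundaries ::
    "('a, 'b) ring_scheme \<Rightarrow> 'a list \<Rightarrow> nat \<Rightarrow> (nat set \<Rightarrow> ('a \<times> 'a) set) set" where
  "cech_coboundaries A xs i =
     (case i of 0 \<Rightarrow> {\<one>\<^bsub>cech_cochains A xs 0\<^esub>}
      | Suc j \<Rightarrow> cech_diff A xs j ` carrier (cech_cochains A xs j))"

definition cech_cohomology ::
    "('a, 'b) ring_scheme \<Rightarrow> 'a list \<Rightarrow> nat \<Rightarrow> (nat set \<Rightarrow> ('a \<times> 'a) set) set monoid" where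
  "cech_cohomology A xs i =
     (cech_cochains A xs i)\<lparr>carrier := cech_cocycles A xs i\<rparr> Mod cech_coboundaries A xs i"

text \<open>In characteristic \<open>p\<close> the Frobenius maps of the localizations commute with the differentials;
  this is the induced map on cohomology classes.\<close>

definition cech_frobenius ::
    "nat \<Rightarrow> ('a, 'b) ring_scheme \<Rightarrow> 'a list \<Rightarrow> nat
      \<Rightarrow> (nat set \<Rightarrow> ('a \<times> 'a) set) set \<Rightarrow> (nat set \<Rightarrow> ('a \<times> 'a) set) set" where
  "cech_frobenius p A xs i C =
     (\<Union>c\<in>C. r_coset (cech_cochains A xs i) (cech_coboundaries A xs i)
        (\<lambda>J \<in> cech_index xs i. frobenius p (localization A (cech_loc A xs J)) (c J)))"

text \<open>Local cohomology of a noetherian local ring \<open>A\<close> at its maximal ideal is computed by the Cech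
  complex on a finite generating list of that ideal. Different lists give canonically isomorphic
  cohomology, compatibly with Frobenius; one list is chosen.\<close>

definition max_ideal_gens :: "('a, 'b) ring_scheme \<Rightarrow> 'a list" where
  "max_ideal_gens A = (SOME xs. set xs \<subseteq> carrier A \<and> Idl\<^bsub>A\<^esub> (set xs) = max_ideal A)"

definition local_cohomology ::
    "('a, 'b) ring_scheme \<Rightarrow> nat \<Rightarrow> (nat set \<Rightarrow> ('a \<times> 'a) set) set monoid" where
  "local_cohomology A i = cech_cohomology A (max_ideal_gens A) i"

definition local_cohomology_frobenius ::
    "nat \<Rightarrow> ('a, 'b) ring_scheme \<Rightarrow> nat
      \<Rightarrow> (nat set \<Rightarrow> ('a \<times> 'a) set) set \<Rightarrow> (nat set \<Rightarrow> ('a \<times> 'a) set) set" where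
  "local_cohomology_frobenius p A i = cech_frobenius p A (max_ideal_gens A) i"

definition F_injective :: "nat \<Rightarrow> ('a, 'b) ring_scheme \<Rightarrow> bool" where
  "F_injective p A \<longleftrightarrow>
     (\<forall>i. inj_on (local_cohomology_frobenius p A i) (carrier (local_cohomology A i)))"

subsection \<open>Tight closure\<close>

definition minimal_prime :: "('a, 'b) ring_scheme \<Rightarrow> 'a set \<Rightarrow> bool" where
  "minimal_prime A Q \<longleftrightarrow> primeideal Q A \<and> (\<forall>Q'. primeideal Q' A \<and> Q' \<subseteq> Q \<longrightarrow> Q' = Q)"

definition frobenius_power :: "('a, 'b) ring_scheme \<Rightarrow> 'a set \<Rightarrow> nat \<Rightarrow> 'a set" where
  "frobenius_power A I q = Idl\<^bsub>A\<^esub> ((\<lambda>a. a [^]\<^bsub>A\<^esub> q) ` I)"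

definition tight_closure :: "nat \<Rightarrow> ('a, 'b) ring_scheme \<Rightarrow> 'a set \<Rightarrow> 'a set" where
  "tight_closure p A I = {z \<in> carrier A.
     \<exists>c \<in> carrier A - \<Union>{Q. minimal_prime A Q}. \<exists>N. \<forall>e\<ge>N.
       c \<otimes>\<^bsub>A\<^esub> z [^]\<^bsub>A\<^esub> (p ^ e) \<in> frobenius_power A I (p ^ e)}"

definition system_of_parameters :: "('a, 'b) ring_scheme \<Rightarrow> 'a list \<Rightarrow> bool" where
  "system_of_parameters A xs \<longleftrightarrow> set xs \<subseteq> max_ideal A \<and> enat (length xs) = krull_dim A \<and>
     ideal_radical A (Idl\<^bsub>A\<^esub> (set xs)) = max_ideal A"

definition partial_system_of_parameters :: "('a, 'b) ring_scheme \<Rightarrow> 'a list \<Rightarrow> bool" where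
  "partial_system_of_parameters A xs \<longleftrightarrow> (\<exists>ys. system_of_parameters A (xs @ ys))"

definition F_rational :: "nat \<Rightarrow> ('a, 'b) ring_scheme \<Rightarrow> bool" where
  "F_rational p A \<longleftrightarrow> (\<forall>xs. partial_system_of_parameters A xs \<longrightarrow>
     tight_closure p A (Idl\<^bsub>A\<^esub> (set xs)) = Idl\<^bsub>A\<^esub> (set xs))"

subsection \<open>The rings of the example\<close>

text \<open>\<open>k[[x,y]]\<close> is represented as \<open>k[[y]][[x]]\<close>: the outer variable is \<open>x\<close> (or \<open>t\<close>), the inner one
  is \<open>y\<close>.\<close>

definition ps_ring :: "'k::field fps fps ring" where
  "ps_ring = ring_of_type_algebra"

definition ps_x :: "'k::field fps fps" where
  "ps_x = fps_X"

definition ps_y :: "'k::field fps fps" where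
  "ps_y = fps_const fps_X"

text \<open>\<open>ext_ring p\<close> is \<open>k[[x,y]][t]/(t\<^sup>p - x)\<close>, with structure map \<open>ext_hom p\<close>.\<close>

definition poly_over_ps :: "'k::field fps fps poly ring" where
  "poly_over_ps = ring_of_type_algebra"

definition ext_ideal :: "nat \<Rightarrow> 'k::field fps fps poly set" where
  "ext_ideal p = PIdl\<^bsub>poly_over_ps\<^esub> (Polynomial.monom 1 p - [:ps_x:])"

definition ext_ring :: "nat \<Rightarrow> 'k::field fps fps poly set ring" where
  "ext_ring p = poly_over_ps Quot ext_ideal p"

definition ext_t :: "nat \<Rightarrow> 'k::field fps fps poly set" where
  "ext_t p = ext_ideal p +>\<^bsub>poly_over_ps\<^esub> Polynomial.monom 1 1"

definition ext_hom :: "nat \<Rightarrow> 'k::field fps fps \<Rightarrow> 'k fps fps poly set" where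
  "ext_hom p f = ext_ideal p +>\<^bsub>poly_over_ps\<^esub> [:f:]"

definition cusp_ideal :: "nat \<Rightarrow> 'k::field fps fps set" where
  "cusp_ideal p = PIdl\<^bsub>ps_ring\<^esub> (ps_y ^ p - ps_x ^ (p + 1))"

end

theory Submission
  imports Defs "HOL-Computational_Algebra.Formal_Laurent_Series"
begin

text \<open>Sending \<open>x\<close> to \<open>s\<^sup>2\<close> and \<open>y\<close> to \<open>s\<^sup>3\<close> identifies \<open>R/P\<close> with the ring \<open>B = k[[s\<^sup>2, s\<^sup>3]]\<close> of all
  power series without linear term. All three failures come from \<open>s\<close> being absent from \<open>B\<close> while
  \<open>s\<^sup>2\<close> is present: \<open>s\<^sup>3\<close> is not in \<open>(s\<^sup>2)\<close>, but its square is in \<open>(s\<^sup>4)\<close>, and it is in the tight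
  closure of the parameter ideal \<open>(s\<^sup>2)\<close>; and \<open>s\<close> defines a nonzero class in the first local
  cohomology whose image \<open>s\<^sup>2\<close> under Frobenius is zero. In \<open>S = k[[t,y]]\<close> the generator of \<open>P\<close>
  becomes \<open>y\<^sup>2 - t\<^sup>6 = (y - t\<^sup>3)\<^sup>2\<close>, so the radical of \<open>PS\<close> is \<open>(y - t\<^sup>3)\<close> and the quotient is the
  discrete valuation ring \<open>k[[t]]\<close>.\<close>

subsection \<open>Division by \<open>y\<^sup>d - x\<^sup>e\<close> and the parametrization of the cusp\<close>

text \<open>The series are nested, and \<open>fps_compose\<close> substitutes for the outer variable
  only. Replacing the inner variable by a power of the outer one mixes all coefficients; taking a
  remainder modulo y - t^3 instead needs no convergence argument and yields a ring homomorphism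
  whose kernel is known at once. The rings R/P and S/sqrt(PS) share one abstract setting: a ring
  embedded in k[[s]] whose image contains s^2 k[[s]] and the inverses of its members with nonzero
  constant term. This already determines the prime ideals and the dimension. The list
  \<open>max_ideal_gens\<close> is an unspecified choice, so the cohomology class of s must be
  written down for every list of generators, possibly with zeros and repetitions. Characteristic 2
  enters in three ways: squaring is additive, a square has no linear coefficient, and y + t^3 equals
  y - t^3. The tight closure argument works for every exponent \<open>p\<close>.\<close>

definition fps_map_const :: "'a::field fps \<Rightarrow> 'a fps fps" where
  "fps_map_const f = Abs_fps (\<lambda>n. fps_const (f $ n))"

lemma fps_map_const_nth [simp]: "fps_map_const f $ n = fps_const (f $ n)"
  by (simp add: fps_map_const_def)

lemma fps_map_const_add: "fps_map_const (f + g) = fps_map_const f + fps_map_const g"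
  by (simp add: fps_eq_iff)

lemma fps_map_const_mult: "fps_map_const (f * g) = fps_map_const f * fps_map_const g"
proof (rule fps_ext)
  fix n
  have "fps_const (\<Sum>i\<in>A. h i) = (\<Sum>i\<in>A. fps_const (h i))" for h :: "nat \<Rightarrow> 'a" and A
    by (induction A rule: infinite_finite_induct) (auto simp flip: fps_const_add)
  then show "fps_map_const (f * g) $ n = (fps_map_const f * fps_map_const g) $ n"
    by (simp add: fps_mult_nth)
qed

lemma fps_map_const_compose_X_power:
  "fps_map_const (f oo fps_X ^ d) = fps_map_const f oo fps_X ^ d"
  by (simp add: fps_eq_iff fps_nth_compose_X_power)

lemma fps_map_const_X_power: "fps_map_const (fps_X ^ d) = fps_X ^ d"
  by (simp add: fps_eq_iff fps_X_power_nth)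

lemma fps_map_const_diff: "fps_map_const (f - g) = fps_map_const f - fps_map_const g"
  by (simp add: fps_eq_iff)

lemma ps_y_power: "ps_y ^ d = fps_const (fps_X ^ d)"
  by (simp add: ps_y_def fps_const_power)

lemma mult_ps_y_diff_ps_x_nth:
  "(q * (ps_y ^ d - ps_x ^ e)) $ n = q $ n * fps_X ^ d - (if e \<le> n then q $ (n - e) else 0)"
  by (simp add: right_diff_distrib ps_y_power ps_x_def fps_X_power_mult_right_nth)

text \<open>Comparing coefficients of \<open>x\<^sup>n\<close> in \<open>f = q (y\<^sup>d - x\<^sup>e) + r\<close> gives this recursion for \<open>q\<close>.\<close>

fun division_coeff :: "nat \<Rightarrow> nat \<Rightarrow> 'a::field fps fps \<Rightarrow> nat \<Rightarrow> 'a fps" where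
  "division_coeff d e f n =
     fps_shift d (f $ n + (if 0 < e \<and> e \<le> n then division_coeff d e f (n - e) else 0))"

declare division_coeff.simps [simp del]

text \<open>The remainder has n-th coefficient f_n + q_(n-e) - y^d q_n. Taking q_n to be the shift
  of f_n + q_(n-e) by d removes exactly the terms of y-degree at least d. Since e is positive, q_n
  depends on earlier coefficients only.\<close>

lemma ps_division:
  fixes f :: "'a::field fps fps"
  assumes "0 < e"
  obtains q r where "f = q * (ps_y ^ d - ps_x ^ e) + r" "\<And>n m. d \<le> m \<Longrightarrow> r $ n $ m = 0"
proof
  define q where "q = Abs_fps (division_coeff d e f)"
  define r where "r = f - q * (ps_y ^ d - ps_x ^ e)"
  show "f = q * (ps_y ^ d - ps_x ^ e) + r"
    by (simp add: r_def)
  fix n m :: nat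
  assume "d \<le> m"
  then show "r $ n $ m = 0"
    using assms unfolding r_def fps_sub_nth mult_ps_y_diff_ps_x_nth
    by (simp add: q_def division_coeff.simps [of d e f n] fps_X_power_mult_right_nth)
qed

text \<open>Uniqueness of the remainder in the case d = 1. Once the earlier coefficients of the
  quotient vanish, a constant equals y times the next one, so both are zero.\<close>

lemma fps_map_const_eq_0_if_dvd:
  fixes r :: "'a::field fps"
  assumes "ps_y - ps_x ^ e dvd fps_map_const r" "0 < e"
  shows "r = 0"
proof -
  obtain q where "fps_map_const r = q * (ps_y - ps_x ^ e)"
    using assms(1) by (metis dvd_def mult.commute)
  then have q: "fps_const (r $ n) = q $ n * fps_X - (if e \<le> n then q $ (n - e) else 0)" for n
    using mult_ps_y_diff_ps_x_nth [of q 1 e n] by (metis fps_map_const_nth power_one_right)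
  have "q $ n = 0" for n
  proof (induction n rule: less_induct)
    case (less n)
    then have eq: "fps_const (r $ n) = q $ n * fps_X"
      using q [of n] assms(2) by simp
    then have "fps_const (r $ n) $ 0 = (q $ n * fps_X) $ 0"
      by simp
    then have "r $ n = 0"
      by simp
    then show ?case
      using eq by simp
  qed
  then have "fps_const (r $ n) = 0" for n
    using q [of n] by simp
  then show ?thesis
    by (metis fps_const_eq_0_iff fps_ext fps_zero_nth)
qed

text \<open>The substitution \<open>y := t\<^sup>3\<close> on \<open>k[[y]][[t]]\<close>, as the remainder modulo \<open>y - t\<^sup>3\<close>.\<close>

definition subst_cube :: "'a::field fps fps \<Rightarrow> 'a fps" where
  "subst_cube g = (THE r. ps_y - ps_x ^ 3 dvd g - fps_map_const r)"

lemma subst_cube_unique: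
  "ps_y - ps_x ^ 3 dvd g - fps_map_const r \<Longrightarrow> ps_y - ps_x ^ 3 dvd g - fps_map_const s \<Longrightarrow> r = s"
  using fps_map_const_eq_0_if_dvd [of 3 "r - s"]
    dvd_diff [of "ps_y - ps_x ^ 3" "g - fps_map_const s" "g - fps_map_const r"]
  by (simp add: fps_map_const_diff)

text \<open>Replaces the description operator by a congruence, so that the ring homomorphism laws
  become statements about divisibility.\<close>

lemma subst_cube_eqI: "ps_y - ps_x ^ 3 dvd g - fps_map_const r \<Longrightarrow> subst_cube g = r"
  unfolding subst_cube_def by (rule the_equality) (auto intro: subst_cube_unique)

lemma subst_cube_dvd: "ps_y - ps_x ^ 3 dvd g - fps_map_const (subst_cube g)"
proof -
  obtain q r where *: "g = q * (ps_y ^ 1 - ps_x ^ 3) + r" "\<And>n m. 1 \<le> m \<Longrightarrow> r $ n $ m = 0"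
    using ps_division [of 3 g 1] by (metis zero_less_numeral)
  \<comment> \<open>For d = 1 no positive power of y survives in the remainder.\<close>
  have "r = fps_map_const (Abs_fps (\<lambda>n. r $ n $ 0))"
    using *(2) by (auto simp: fps_eq_iff)
  then have "ps_y - ps_x ^ 3 dvd g - fps_map_const (Abs_fps (\<lambda>n. r $ n $ 0))"
    using *(1) by simp
  then show ?thesis
    using subst_cube_eqI by metis
qed

lemma subst_cube_add: "subst_cube (g + h) = subst_cube g + subst_cube h"
  using dvd_add [OF subst_cube_dvd [of g] subst_cube_dvd [of h]]
  by (intro subst_cube_eqI) (simp add: fps_map_const_add algebra_simps)

lemma subst_cube_mult: "subst_cube (g * h) = subst_cube g * subst_cube h"
proof (rule subst_cube_eqI)
  have "g * h - fps_map_const (subst_cube g * subst_cube h) =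
    (g - fps_map_const (subst_cube g)) * h + fps_map_const (subst_cube g) * (h - fps_map_const (subst_cube h))"
    by (simp add: fps_map_const_mult algebra_simps)
  then show "ps_y - ps_x ^ 3 dvd g * h - fps_map_const (subst_cube g * subst_cube h)"
    using subst_cube_dvd by (metis dvd_add dvd_mult dvd_mult2)
qed

lemma subst_cube_map_const [simp]: "subst_cube (fps_map_const r) = r"
  by (rule subst_cube_eqI) simp

lemma subst_cube_ps_y [simp]: "subst_cube ps_y = fps_X ^ 3"
  by (rule subst_cube_eqI) (simp add: fps_map_const_X_power ps_x_def)

lemma subst_cube_X_power [simp]: "subst_cube (fps_X ^ d) = fps_X ^ d"
  using subst_cube_map_const [of "fps_X ^ d"] by (simp add: fps_map_const_X_power)

lemma subst_cube_1 [simp]: "subst_cube 1 = 1"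
  using subst_cube_X_power [of 0] by simp

lemma subst_cube_eq_0_iff: "subst_cube g = 0 \<longleftrightarrow> ps_y - ps_x ^ 3 dvd g"
proof -
  have "fps_map_const 0 = (0 :: 'a fps fps)"
    by (simp add: fps_eq_iff)
  then show ?thesis
    using subst_cube_dvd [of g] subst_cube_eqI [of g 0] by auto
qed

lemma subst_cube_0 [simp]: "subst_cube 0 = 0"
  by (simp add: subst_cube_eq_0_iff)

section \<open>Parity of exponents and the map x -> s^2, y -> s^3\<close>

lemma fps_even_odd:
  fixes f :: "'a::comm_ring_1 fps"
  shows "f = (Abs_fps (\<lambda>n. f $ (2 * n)) oo fps_X ^ 2) +
    fps_X * (Abs_fps (\<lambda>n. f $ (2 * n + 1)) oo fps_X ^ 2)"
  by (rule fps_ext) (auto simp: fps_nth_compose_X_power elim!: oddE)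

text \<open>The two summands live in exponents of different parity and cannot cancel. The case d = 3
  serves the cusp, the case d = 1 the extension by t.\<close>

lemma fps_even_odd_eq_0:
  fixes f g :: "'a::comm_ring_1 fps"
  assumes "(f oo fps_X ^ 2) + fps_X ^ d * (g oo fps_X ^ 2) = 0" "odd d"
  shows "f = 0" "g = 0"
proof -
  have *: "((f oo fps_X ^ 2) + fps_X ^ d * (g oo fps_X ^ 2)) $ n = 0" for n
    using assms by simp
  show "f = 0"
  proof (rule fps_ext)
    fix n
    show "f $ n = 0 $ n"
      using *[of "2 * n"] assms(2) by (auto simp: fps_nth_compose_X_power fps_X_power_mult_nth split: if_splits)
  qed
  show "g = 0"
  proof (rule fps_ext)
    fix n
    show "g $ n = 0 $ n"
      using *[of "2 * n + d"] assms(2) by (auto simp: fps_nth_compose_X_power fps_X_power_mult_nth split: if_splits)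
  qed
qed

text \<open>Composition performs x -> s^2, after which \<open>subst_cube\<close> performs y -> s^3.
  The intermediate ring is k[[t,y]], so this is the composite R -> S -> k[[t]] that reappears in the
  computation of the radical.\<close>

definition cusp_param :: "'a::field fps fps \<Rightarrow> 'a fps" where
  "cusp_param f = subst_cube (f oo fps_X ^ 2)"

lemma cusp_param_add: "cusp_param (f + g) = cusp_param f + cusp_param g"
  by (simp add: cusp_param_def fps_compose_add_distrib subst_cube_add)

lemma cusp_param_mult: "cusp_param (f * g) = cusp_param f * cusp_param g"
  by (simp add: cusp_param_def fps_compose_mult_distrib subst_cube_mult)

lemma cusp_param_1 [simp]: "cusp_param 1 = 1"
  by (simp add: cusp_param_def)

lemma cusp_param_0 [simp]: "cusp_param 0 = 0"
  by (simp add: cusp_param_def)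

lemma cusp_param_map_const: "cusp_param (fps_map_const f) = f oo fps_X ^ 2"
  by (simp add: cusp_param_def flip: fps_map_const_compose_X_power)

lemma cusp_param_ps_y: "cusp_param ps_y = fps_X ^ 3"
  by (simp add: cusp_param_def ps_y_def) (simp flip: ps_y_def)

text \<open>The first factor puts the generator of P into the kernel of \<open>cusp_param\<close>.
  In characteristic 2 the factors coincide, which is what makes PS differ from its radical.\<close>

lemma ps_y_square_minus_ps_x_cube_compose:
  "((ps_y ^ 2 - ps_x ^ 3 :: 'a::field fps fps) oo fps_X ^ 2) = (ps_y - ps_x ^ 3) * (ps_y + ps_x ^ 3)"
proof -
  have "((ps_y ^ 2 - ps_x ^ 3 :: 'a fps fps) oo fps_X ^ 2) = ps_y ^ 2 - ps_x ^ 6"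
    by (simp add: fps_compose_sub_distrib ps_y_power ps_x_def flip: fps_compose_power power_mult)
  then show ?thesis
    by (simp add: algebra_simps power2_eq_square flip: power_add)
qed

lemma cusp_param_generator [simp]: "cusp_param (ps_y ^ 2 - ps_x ^ 3) = 0"
  unfolding cusp_param_def ps_y_square_minus_ps_x_cube_compose by (simp add: subst_cube_eq_0_iff)

text \<open>Division by a polynomial of degree 2 in y leaves a remainder a + y b with a and b in
  k[[x]]. Its image has even part from a and odd part from b, so kernel and image of
  \<open>cusp_param\<close> can both be read off.\<close>

lemma cusp_normal_form:
  fixes f :: "'a::field fps fps"
  obtains q a b where "f = q * (ps_y ^ 2 - ps_x ^ 3) + (fps_map_const a + ps_y * fps_map_const b)"
    "cusp_param f = (a oo fps_X ^ 2) + fps_X ^ 3 * (b oo fps_X ^ 2)"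
proof -
  obtain q r where *: "f = q * (ps_y ^ 2 - ps_x ^ 3) + r" "\<And>n m. 2 \<le> m \<Longrightarrow> r $ n $ m = 0"
    using ps_division [of 3 f 2] by (metis zero_less_numeral)
  define a b where "a = Abs_fps (\<lambda>n. r $ n $ 0)" and "b = Abs_fps (\<lambda>n. r $ n $ 1)"
  have r: "r = fps_map_const a + ps_y * fps_map_const b"
  proof (intro fps_ext)
    fix n m
    show "r $ n $ m = (fps_map_const a + ps_y * fps_map_const b) $ n $ m"
      using *(2) [of m n] by (cases m) (auto simp: a_def b_def ps_y_def)
  qed
  show thesis
    using that [of q a b] *(1)
    by (simp add: r cusp_param_add cusp_param_mult cusp_param_map_const cusp_param_ps_y)
qed

text \<open>By parity a remainder that maps to 0 is 0. This identifies R/P with a subring of k[[s]]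
  and so makes P prime.\<close>

lemma cusp_param_eq_0_iff: "cusp_param f = 0 \<longleftrightarrow> ps_y ^ 2 - ps_x ^ 3 dvd f"
proof
  assume f: "cusp_param f = 0"
  obtain q a b where *: "f = q * (ps_y ^ 2 - ps_x ^ 3) + (fps_map_const a + ps_y * fps_map_const b)"
    "cusp_param f = (a oo fps_X ^ 2) + fps_X ^ 3 * (b oo fps_X ^ 2)"
    by (rule cusp_normal_form)
  then have "a = 0" "b = 0"
    using f fps_even_odd_eq_0 [of a 3 b] by auto
  moreover have "fps_map_const 0 = (0 :: 'a fps fps)"
    by (simp add: fps_eq_iff)
  ultimately show "ps_y ^ 2 - ps_x ^ 3 dvd f"
    using *(1) by simp
qed (auto simp: cusp_param_mult)

text \<open>The number 1 is the only exponent that is neither even nor 3 plus an even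
  number.\<close>

lemma range_cusp_param: "range cusp_param = {f. f $ 1 = 0}"
proof (intro equalityI subsetI)
  fix f :: "'a fps"
  assume f: "f \<in> {f. f $ 1 = 0}"
  define a b where "a = Abs_fps (\<lambda>n. f $ (2 * n))" and "b = Abs_fps (\<lambda>n. f $ (2 * n + 3))"
  have "f = (a oo fps_X ^ 2) + fps_X ^ 3 * (b oo fps_X ^ 2)"
  proof (rule fps_ext)
    fix n
    show "f $ n = ((a oo fps_X ^ 2) + fps_X ^ 3 * (b oo fps_X ^ 2)) $ n"
    proof (cases "n < 3")
      case True
      then have "n = 0 \<or> n = 1 \<or> n = 2" by auto
      with f show ?thesis
        by (auto simp: fps_nth_compose_X_power fps_X_power_mult_nth a_def)
    next
      case False
      then show ?thesis
        by (auto simp: fps_nth_compose_X_power fps_X_power_mult_nth a_def b_def)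
    qed
  qed
  also have "\<dots> = cusp_param (fps_map_const a + ps_y * fps_map_const b)"
    by (simp add: cusp_param_add cusp_param_mult cusp_param_map_const cusp_param_ps_y)
  finally show "f \<in> range cusp_param"
    by blast
next
  fix f :: "'a fps"
  assume "f \<in> range cusp_param"
  then obtain g where g: "f = cusp_param g"
    by blast
  obtain a b where *: "cusp_param g = (a oo fps_X ^ 2) + fps_X ^ 3 * (b oo fps_X ^ 2)"
    by (rule cusp_normal_form)
  show "f \<in> {f. f $ 1 = 0}"
    by (simp add: g * fps_nth_compose_X_power fps_X_power_mult_nth)
qed

subsection \<open>Subrings of \<open>k[[s]]\<close> containing \<open>s\<^sup>2 k[[s]]\<close>\<close>

lemma ring_of_type_algebra_simps [simp]:
  "carrier ring_of_type_algebra = UNIV"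
  "x \<otimes>\<^bsub>ring_of_type_algebra\<^esub> y = x * y"
  "x \<oplus>\<^bsub>ring_of_type_algebra\<^esub> y = x + y"
  "\<one>\<^bsub>ring_of_type_algebra\<^esub> = 1"
  "\<zero>\<^bsub>ring_of_type_algebra\<^esub> = 0"
  by (simp_all add: ring_of_type_algebra_def)

lemma (in primeideal) I_prime_power:
  assumes "a \<in> carrier R" "a [^] (n::nat) \<in> I"
  shows "a \<in> I"
  using assms(2)
proof (induction n)
  case 0
  then show ?case
    using I_notcarr one_imp_carrier by simp
next
  case (Suc n)
  then show ?case
    using I_prime [of "a [^] n" a] assms(1) by auto
qed

text \<open>The setting common to k[[s^2, s^3]] and k[[t]]. The assumption \<open>conductor\<close>
  says that s^2 k[[s]] lies in the image; \<open>inverse_image\<close> makes every element with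
  nonzero constant term a unit of \<open>B\<close>.\<close>

locale power_series_subring = cring B for B :: "('b, 'c) ring_scheme" (structure) +
  fixes h :: "'b \<Rightarrow> 'k::field fps"
  assumes h_hom: "h \<in> ring_hom B ring_of_type_algebra"
    and h_inj: "inj_on h (carrier B)"
    and conductor: "f $ 0 = 0 \<Longrightarrow> f $ 1 = 0 \<Longrightarrow> f \<in> h ` carrier B"
    and inverse_image: "b \<in> carrier B \<Longrightarrow> h b $ 0 \<noteq> 0 \<Longrightarrow> inverse (h b) \<in> h ` carrier B"
begin

lemma h_mult [simp]: "a \<in> carrier B \<Longrightarrow> b \<in> carrier B \<Longrightarrow> h (a \<otimes> b) = h a * h b"
  by (simp add: ring_hom_mult [OF h_hom])

lemma h_add [simp]: "a \<in> carrier B \<Longrightarrow> b \<in> carrier B \<Longrightarrow> h (a \<oplus> b) = h a + h b"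
  by (simp add: ring_hom_add [OF h_hom])

lemma h_one [simp]: "h \<one> = 1"
  by (simp add: ring_hom_one [OF h_hom])

lemma h_zero [simp]: "h \<zero> = 0"
  by (metis add_cancel_left_left h_add l_zero zero_closed)

lemma h_pow [simp]: "a \<in> carrier B \<Longrightarrow> h (a [^] (n::nat)) = h a ^ n"
  by (induction n) auto

lemma h_eqI: "a \<in> carrier B \<Longrightarrow> b \<in> carrier B \<Longrightarrow> h a = h b \<Longrightarrow> a = b"
  using h_inj by (auto dest: inj_onD)

lemma h_eq_0_iff: "a \<in> carrier B \<Longrightarrow> h a = 0 \<longleftrightarrow> a = \<zero>"
  using h_eqI [of a \<zero>] by auto

definition elem :: "'k fps \<Rightarrow> 'b" where
  "elem f = the_inv_into (carrier B) h f"

lemma elem_closed: "f \<in> h ` carrier B \<Longrightarrow> elem f \<in> carrier B"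
  unfolding elem_def using h_inj the_inv_into_into by fastforce

lemma h_elem: "f \<in> h ` carrier B \<Longrightarrow> h (elem f) = f"
  unfolding elem_def using h_inj by (rule f_the_inv_into_f)

text \<open>The factor s^2 brings any series into the image of \<open>h\<close>, so this is total on
  k[[s]]. In particular \<open>lift 1\<close> stands for s^2 and \<open>lift fps_X\<close> for
  s^3.\<close>

definition lift :: "'k fps \<Rightarrow> 'b" where
  "lift f = elem (fps_X ^ 2 * f)"

lemma lift [simp]: "lift f \<in> carrier B" "h (lift f) = fps_X ^ 2 * f"
proof -
  have "fps_X ^ 2 * f \<in> h ` carrier B"
    by (rule conductor) (simp_all add: fps_X_power_mult_nth)
  then show "lift f \<in> carrier B" "h (lift f) = fps_X ^ 2 * f"
    unfolding lift_def by (simp_all add: elem_closed h_elem)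
qed

lemma is_domain: "domain B"
proof
  show "\<one> \<noteq> \<zero>"
    by (metis h_one h_zero zero_neq_one)
  show "a = \<zero> \<or> b = \<zero>" if "a \<otimes> b = \<zero>" "a \<in> carrier B" "b \<in> carrier B" for a b
    using that h_mult [of a b] by (auto simp flip: h_eq_0_iff)
qed

definition pos_ideal :: "'b set" where
  "pos_ideal = {b \<in> carrier B. h b $ 0 = 0}"

lemma primeideal_pos_ideal: "primeideal pos_ideal B"
proof -
  have "h (\<ominus> a) = - h a" if "a \<in> carrier B" for a
    using h_add [of "\<ominus> a" a] that by (simp add: l_neg eq_neg_iff_add_eq_0)
  then have "ideal pos_ideal B"
    unfolding pos_ideal_def
    by (intro idealI ring_axioms add.subgroupI) (auto simp flip: a_inv_def intro!: exI[of _ "\<zero>"])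
  moreover have "carrier B \<noteq> pos_ideal"
    unfolding pos_ideal_def using one_closed by force
  ultimately show ?thesis
    by (rule primeidealI [OF _ cring_axioms]) (auto simp: pos_ideal_def)
qed

lemma lift_pos_ideal [simp]: "lift f \<in> pos_ideal"
  by (simp add: pos_ideal_def fps_X_power_mult_nth)

lemma lift_eq_0_iff [simp]: "lift f = \<zero> \<longleftrightarrow> f = 0"
  by (simp flip: h_eq_0_iff)

lemma pos_idealE:
  assumes "a \<in> pos_ideal"
  obtains w where "a \<in> carrier B" "h a = fps_X * w"
proof -
  have "h a = fps_X * fps_shift 1 (h a)"
    using assms by (intro fps_ext) (auto simp: pos_ideal_def fps_X_mult_nth)
  then show thesis
    using assms that unfolding pos_ideal_def by blast
qed

lemma pos_ideal_nonzero: "pos_ideal \<noteq> {\<zero>}"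
  by (metis lift_eq_0_iff lift_pos_ideal singletonD zero_neq_one)

text \<open>A nonzero prime contains some s^(n+2), of which every element without constant term has
  a power as a multiple. An element with constant term is a unit and cannot lie in a prime.\<close>

lemma primeideal_cases:
  assumes "primeideal Q B" "Q \<noteq> {\<zero>}"
  shows "Q = pos_ideal"
proof -
  interpret Q: primeideal Q B
    by fact
  obtain b where b: "b \<in> Q" "b \<noteq> \<zero>"
    using assms(2) Q.zero_closed by blast
  then have bc: "b \<in> carrier B"
    using Q.a_Hcarr by blast
  define n u where "n = subdegree (h b)" and "u = unit_factor (h b)"
  have hb: "h b = fps_X ^ n * u" and u: "u * inverse u = 1"
    using b(2) bc subdegree_decompose [of "h b"]
    by (auto simp: n_def u_def h_eq_0_iff inverse_mult_eq_1' mult.commute)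
  \<comment> \<open>The inverse of the unit factor may lie outside the image of \<open>h\<close>;
    s^2 times it does not.\<close>
  define c where "c = lift (inverse u)"
  have c: "c \<in> carrier B" "h c = fps_X ^ 2 * inverse u"
    by (simp_all add: c_def)
  have "h (b \<otimes> c) = fps_X ^ (n + 2) * (u * inverse u)"
    using c bc by (simp only: h_mult hb power_add ac_simps)
  then have bcQ: "b \<otimes> c \<in> Q" "h (b \<otimes> c) = fps_X ^ (n + 2)"
    using Q.I_r_closed [OF b(1) c(1)] u by simp_all
  have "g \<in> Q" if g: "g \<in> pos_ideal" for g
  proof -
    obtain w where gc: "g \<in> carrier B" and w: "h g = fps_X * w"
      using g by (rule pos_idealE)
    \<comment> \<open>Of the n + 4 factors s in the power of \<open>g\<close>, n + 2 give the
      element of \<open>Q\<close> and the last two keep the cofactor inside the image of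
      \<open>h\<close>.\<close>
    let ?d = "lift (w ^ (n + 2 + 2))"
    have "h (g [^] (n + 2 + 2)) = fps_X ^ (n + 2) * (fps_X ^ 2 * w ^ (n + 2 + 2))"
      using gc by (simp only: h_pow w power_mult_distrib power_add [of fps_X "n + 2"] mult.assoc)
    also have "\<dots> = h ((b \<otimes> c) \<otimes> ?d)"
      using bc c(1) by (subst h_mult) (simp_all only: m_closed lift bcQ(2))
    finally have "g [^] (n + 2 + 2) = (b \<otimes> c) \<otimes> ?d"
      using gc bc c(1) by (intro h_eqI) auto
    also have "\<dots> \<in> Q"
      using Q.I_r_closed [OF bcQ(1)] by simp
    finally show ?thesis
      using Q.I_prime_power gc by blast
  qed
  moreover have "g \<in> pos_ideal" if g: "g \<in> Q" for g
  proof (rule ccontr)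
    assume "g \<notin> pos_ideal"
    then have *: "g \<in> carrier B" "h g $ 0 \<noteq> 0"
      using g Q.a_Hcarr by (auto simp: pos_ideal_def)
    then have e: "elem (inverse (h g)) \<in> carrier B" "h (elem (inverse (h g))) = inverse (h g)"
      using inverse_image elem_closed h_elem by auto
    have "g \<otimes> elem (inverse (h g)) = \<one>"
      using * e by (intro h_eqI) (auto simp: inverse_mult_eq_1')
    then have "\<one> \<in> Q"
      using Q.I_r_closed [OF g e(1)] by simp
    then show False
      using Q.one_imp_carrier Q.I_notcarr by blast
  qed
  ultimately show ?thesis
    by blast
qed

lemma primeideal_iff: "primeideal Q B \<longleftrightarrow> Q = {\<zero>} \<or> Q = pos_ideal"
  using primeideal_cases primeideal_pos_ideal domain.zeroprimeideal [OF is_domain] by blast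

lemma maximalideal_iff: "maximalideal M B \<longleftrightarrow> M = pos_ideal"
proof -
  interpret pos: primeideal pos_ideal B
    by (rule primeideal_pos_ideal)
  have "M = pos_ideal" if M: "maximalideal M B" for M
  proof (rule primeideal_cases [OF maximalideal_prime [OF M]])
    show "M \<noteq> {\<zero>}"
      using maximalideal.I_maximal [OF M pos.ideal_axioms _ pos.a_subset] pos.zero_closed
        pos_ideal_nonzero pos.I_notcarr by blast
  qed
  moreover have "maximalideal pos_ideal B"
  proof (rule maximalidealI)
    fix J
    assume J: "ideal J B" "pos_ideal \<subseteq> J" "J \<subseteq> carrier B"
    interpret J: ideal J B
      by fact
    show "J = pos_ideal \<or> J = carrier B"
    proof (rule disjCI)
      assume "J \<noteq> carrier B"
      have "h b $ 0 = 0" if b: "b \<in> J" for b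
      proof (rule ccontr)
        assume "h b $ 0 \<noteq> 0"
        moreover have bc: "b \<in> carrier B"
          using b by (rule J.a_Hcarr)
        ultimately have e: "elem (inverse (h b)) \<in> carrier B" "h (elem (inverse (h b))) = inverse (h b)"
          using inverse_image elem_closed h_elem by auto
        have "b \<otimes> elem (inverse (h b)) = \<one>"
          using bc \<open>h b $ 0 \<noteq> 0\<close> e by (intro h_eqI) (auto simp: inverse_mult_eq_1')
        then show False
          using J.I_r_closed [OF b e(1)] J.one_imp_carrier \<open>J \<noteq> carrier B\<close> by simp
      qed
      then show "J = pos_ideal"
        using J(2,3) unfolding pos_ideal_def by blast
    qed
  qed (rule pos.ideal_axioms pos.I_notcarr)+
  ultimately show ?thesis
    by blast
qed

lemma is_local_ring: "local_ring B"
  unfolding local_ring_def using cring_axioms by (simp add: maximalideal_iff)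

lemma max_ideal_eq: "max_ideal B = pos_ideal"
  unfolding max_ideal_def by (simp add: maximalideal_iff)

lemma krull_dim_eq_1: "krull_dim B = 1"
  unfolding krull_dim_def
proof (rule Sup_eqI)
  fix y
  assume "y \<in> {enat n | n. \<exists>C :: nat \<Rightarrow> 'b set.
      (\<forall>i\<le>n. primeideal (C i) B) \<and> (\<forall>i<n. C i \<subset> C (Suc i))}"
  then obtain n and C :: "nat \<Rightarrow> 'b set"
    where n: "y = enat n" "\<forall>i\<le>n. primeideal (C i) B" "\<forall>i<n. C i \<subset> C (Suc i)"
    by blast
  have "n \<le> 1"
  proof (rule ccontr)
    assume "\<not> n \<le> 1"
    then have C: "C 0 \<subset> C 1" "C 1 \<subset> C 2"
      and prime: "primeideal (C 0) B" "primeideal (C 1) B" "primeideal (C 2) B"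
      using n(2,3) by (auto simp: numeral_2_eq_2)
    have zero: "\<zero> \<in> C 0"
      using prime(1) by (meson additive_subgroup.zero_closed ideal.axioms(1) primeideal.axioms(1))
    \<comment> \<open>Two nonzero primes in the chain would both be \<open>pos_ideal\<close>,
      against strict inclusion.\<close>
    then have "C 1 \<noteq> {\<zero>}" "C 2 \<noteq> {\<zero>}"
      using C by auto
    then show False
      using primeideal_cases prime C(2) by blast
  qed
  then show "y \<le> 1"
    using n(1) by (simp add: one_enat_def)
next
  fix y
  assume y: "\<And>z. z \<in> {enat n | n. \<exists>C :: nat \<Rightarrow> 'b set.
      (\<forall>i\<le>n. primeideal (C i) B) \<and> (\<forall>i<n. C i \<subset> C (Suc i))} \<Longrightarrow> z \<le> y"
  have "\<zero> \<in> pos_ideal"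
    by (simp add: pos_ideal_def)
  then have "{\<zero>} \<subset> pos_ideal"
    using pos_ideal_nonzero by blast
  then have "\<exists>C :: nat \<Rightarrow> 'b set. (\<forall>i\<le>1. primeideal (C i) B) \<and> (\<forall>i<1. C i \<subset> C (Suc i))"
    by (intro exI [of _ "\<lambda>i. if i = 0 then {\<zero>} else pos_ideal"]) (simp add: primeideal_iff)
  then have "enat 1 \<le> y"
    by (intro y) blast
  then show "1 \<le> y"
    by (simp add: one_enat_def)
qed

text \<open>Cancelling s^2 in k[[s]] would turn the cofactor into s itself.\<close>

lemma lift_X_notin:
  assumes "fps_X \<notin> h ` carrier B"
  shows "lift fps_X \<notin> PIdl (lift 1)"
proof
  assume "lift fps_X \<in> PIdl (lift 1)"
  then obtain b where b: "b \<in> carrier B" "lift fps_X = b \<otimes> lift 1"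
    unfolding cgenideal_def by auto
  then have "fps_X ^ 2 * fps_X = h b * fps_X ^ 2"
    using h_mult [of b "lift 1"] lift by (metis mult.right_neutral)
  then have "h b = fps_X"
    by simp
  then show False
    using assms imageI [OF b(1), of h] by simp
qed

text \<open>Writing \<open>s\<close> for \<open>fps_X\<close>: the parameter ideal \<open>(s\<^sup>2)\<close> has \<open>s\<^sup>3\<close> in its tight closure because
  \<open>s\<^sup>2 (s\<^sup>3)\<^sup>q = (s\<^sup>2)\<^sup>q s\<^sup>q\<^sup>+\<^sup>2\<close>, but does not contain it, since \<open>s\<close> is not in \<open>B\<close>.\<close>

lemma not_F_rational:
  assumes "fps_X \<notin> h ` carrier B"
  shows "\<not> F_rational p B"
proof
  assume F: "F_rational p B"
  let ?x = "lift 1"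
  let ?y = "lift fps_X"
  let ?I = "Idl {?x}"
  have I: "?I = PIdl ?x" "?x \<in> ?I" "ideal ?I B"
    by (simp_all add: cgenideal_eq_genideal genideal_self' genideal_ideal)
  have sub: "?I \<subseteq> pos_ideal"
    by (intro genideal_minimal) (auto intro: primeideal.axioms primeideal_pos_ideal)
  have "ideal_radical B ?I = pos_ideal"
  proof (intro equalityI subsetI)
    fix a
    assume "a \<in> ideal_radical B ?I"
    then show "a \<in> pos_ideal"
      unfolding ideal_radical_def using sub primeideal.I_prime_power [OF primeideal_pos_ideal] by blast
  next
    fix a
    assume "a \<in> pos_ideal"
    then obtain w where a: "a \<in> carrier B" and w: "h a = fps_X * w"
      by (rule pos_idealE)
    \<comment> \<open>Fourth powers suffice: two factors s give the generator s^2, two more keep the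
      cofactor s^2 w^4 in the ring.\<close>
    have "h (a [^] (4::nat)) = fps_X ^ 2 * (fps_X ^ 2 * w ^ 4)"
      using a power_add [of "fps_X :: 'k fps" 2 2] by (simp add: w power_mult_distrib mult.assoc)
    then have "a [^] (4::nat) = ?x \<otimes> lift (w ^ 4)"
      using a by (intro h_eqI) auto
    then have "a [^] (4::nat) \<in> ?I"
      using ideal.I_r_closed [OF I(3,2) lift(1)] by simp
    then show "a \<in> ideal_radical B ?I"
      unfolding ideal_radical_def using a by blast
  qed
  then have "system_of_parameters B [?x]"
    unfolding system_of_parameters_def by (simp add: max_ideal_eq krull_dim_eq_1 one_enat_def)
  then have "tight_closure p B ?I = ?I"
    using F unfolding F_rational_def partial_system_of_parameters_def
    by (metis append_Nil2 empty_set list.simps(15))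
  moreover have "?y \<in> tight_closure p B ?I"
  proof -
    \<comment> \<open>The multiplier in the tight closure is s^2. It has to avoid the minimal
      primes, and a domain has only the zero ideal as such.\<close>
    have "?x \<notin> Q" if Q: "minimal_prime B Q" for Q
    proof -
      have "\<zero> \<in> Q"
        using Q unfolding minimal_prime_def
        by (meson additive_subgroup.zero_closed ideal.axioms(1) primeideal.axioms(1))
      then have "Q = {\<zero>}"
        using Q domain.zeroprimeideal [OF is_domain] unfolding minimal_prime_def by blast
      then show ?thesis
        by simp
    qed
    moreover have "?x \<otimes> ?y [^] (p ^ e) \<in> frobenius_power B ?I (p ^ e)" for e
    proof -
      let ?q = "p ^ e"
      let ?J = "frobenius_power B ?I ?q"
      have sub: "(\<lambda>a. a [^] ?q) ` ?I \<subseteq> carrier B"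
        using I(3) by (auto dest: ideal.Icarr)
      then have J: "ideal ?J B" "?x [^] ?q \<in> ?J"
        unfolding frobenius_power_def using genideal_ideal genideal_self I(2) by blast+
      have "?x \<otimes> ?y [^] ?q = ?x [^] ?q \<otimes> lift (fps_X ^ ?q)"
        by (intro h_eqI) (auto simp: power_mult_distrib algebra_simps)
      then show ?thesis
        using ideal.I_r_closed [OF J lift(1)] by simp
    qed
    ultimately show ?thesis
      unfolding tight_closure_def by (intro CollectI conjI bexI [of _ ?x] exI [of _ 0]) auto
  qed
  ultimately show False
    using lift_X_notin [OF assms] I(1) by simp
qed

text \<open>Here \<open>B\<close> is a copy of k[[s]]: an element of least order generates its
  ideal, so every ideal is principal, and s generates the maximal one.\<close>

lemma regular_local_ring_if_surj:
  assumes surj: "h ` carrier B = UNIV"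
  shows "regular_local_ring B"
proof -
  have e [simp]: "elem f \<in> carrier B" "h (elem f) = f" for f
    using surj elem_closed h_elem by auto
  have principal: "\<exists>b\<in>carrier B. I = PIdl b" if "ideal I B" for I
  proof (cases "I = {\<zero>}")
    case True
    then show ?thesis
      using genideal_zero cgenideal_eq_genideal by auto
  next
    case False
    interpret I: ideal I B
      by fact
    obtain c where "c \<in> I - {\<zero>}"
      using False I.zero_closed by blast
    then obtain b where b: "b \<in> I - {\<zero>}" and
      min: "\<And>a. a \<in> I - {\<zero>} \<Longrightarrow> subdegree (h b) \<le> subdegree (h a)"
      using ex_has_least_nat [of "\<lambda>a. a \<in> I - {\<zero>}" c "\<lambda>a. subdegree (h a)"] by blast
    have bc: "b \<in> carrier B"
      using b I.a_Hcarr by blast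
    have "a \<in> PIdl b" if a: "a \<in> I" for a
    proof -
      have ac: "a \<in> carrier B"
        using a I.a_Hcarr by blast
      have "h b dvd h a"
      proof (cases "a = \<zero>")
        case False
        then show ?thesis
          using a b ac bc min by (subst fps_dvd_iff) (auto simp: h_eq_0_iff)
      qed auto
      then obtain f where "h a = h b * f" ..
      then have "a = elem f \<otimes> b"
        using ac bc by (intro h_eqI) auto
      then show ?thesis
        unfolding cgenideal_def by auto
    qed
    then show ?thesis
      using b bc cgenideal_minimal [OF that, of b] by blast
  qed
  have "noetherian_ring B"
  proof (rule noetherian_ringI)
    fix I
    assume "ideal I B"
    then obtain b where "b \<in> carrier B" "I = Idl {b}"
      using principal cgenideal_eq_genideal by metis
    then show "\<exists>A\<subseteq>carrier B. finite A \<and> I = Idl A"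
      by blast
  qed
  moreover have "embedding_dim B = 1"
    unfolding embedding_dim_def
  proof (rule Least_equality)
    have "PIdl (elem fps_X) = pos_ideal"
    proof (intro equalityI subsetI)
      fix a
      assume "a \<in> pos_ideal"
      then obtain w where a: "a \<in> carrier B" and w: "h a = fps_X * w"
        by (rule pos_idealE)
      have "a = elem w \<otimes> elem fps_X"
        using a by (intro h_eqI) (auto simp: w)
      then show "a \<in> PIdl (elem fps_X)"
        unfolding cgenideal_def by auto
    qed (auto simp: cgenideal_def pos_ideal_def)
    then show "\<exists>G\<subseteq>carrier B. finite G \<and> card G = 1 \<and> Idl G = max_ideal B"
      by (intro exI [of _ "{elem fps_X}"]) (simp add: max_ideal_eq cgenideal_eq_genideal)
  next
    fix n
    assume "\<exists>G\<subseteq>carrier B. finite G \<and> card G = n \<and> Idl G = max_ideal B"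
    \<comment> \<open>Rules out n = 0: no elements generate only the zero ideal, whereas
      \<open>pos_ideal\<close> contains \<open>lift 1\<close>.\<close>
    moreover have "Idl {} \<subseteq> {\<zero>}"
      by (rule genideal_minimal) (auto intro: zeroideal)
    ultimately show "1 \<le> n"
      using lift_pos_ideal [of 1] lift_eq_0_iff [of 1]
      by (cases n) (auto simp: max_ideal_eq simp del: lift_pos_ideal lift_eq_0_iff)
  qed
  ultimately show ?thesis
    unfolding regular_local_ring_def using is_local_ring krull_dim_eq_1 by (simp add: one_enat_def)
qed

end

subsection \<open>Tensor products and purity\<close>

lemma module_along_simps [simp]:
  "carrier (module_along f B) = carrier B"
  "\<zero>\<^bsub>module_along f B\<^esub> = \<zero>\<^bsub>B\<^esub>"
  "x \<oplus>\<^bsub>module_along f B\<^esub> y = x \<oplus>\<^bsub>B\<^esub> y"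
  "a \<odot>\<^bsub>module_along f B\<^esub> x = f a \<otimes>\<^bsub>B\<^esub> x"
  by (simp_all add: module_along_def)

lemma module_module_along:
  assumes "cring A" "ring B" "f \<in> ring_hom A B"
  shows "module A (module_along f B)"
proof -
  interpret A: cring A by fact
  interpret B: ring B by fact
  interpret f: ring_hom_ring A B f
    using assms by (intro ring_hom_ringI2) (auto intro: A.ring_axioms)
  have "abelian_group (module_along f B)"
    by (rule abelian_groupI)
      (auto simp: B.a_ac intro: bexI [of _ "\<ominus>\<^bsub>B\<^esub> x" for x])
  then show ?thesis
    by (intro moduleI A.cring_axioms) (auto simp: B.l_distr B.r_distr B.m_assoc)
qed

text \<open>Purity is tested on modules over a fixed element type, which differs from that of A/(x).
  This copies a module along an injection \<open>e\<close> with left inverse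
  \<open>d\<close>.\<close>

definition transport_module ::
    "('m \<Rightarrow> 'n) \<Rightarrow> ('n \<Rightarrow> 'm) \<Rightarrow> ('a, 'm, 'c) module_scheme \<Rightarrow> ('a, 'n) module" where
  "transport_module e d M = \<lparr>carrier = e ` carrier M,
     monoid.mult = (\<lambda>x y. e (d x \<otimes>\<^bsub>M\<^esub> d y)), one = e \<one>\<^bsub>M\<^esub>, ring.zero = e \<zero>\<^bsub>M\<^esub>,
     add = (\<lambda>x y. e (d x \<oplus>\<^bsub>M\<^esub> d y)), module.smult = (\<lambda>a x. e (a \<odot>\<^bsub>M\<^esub> d x))\<rparr>"

lemma transport_module_simps [simp]:
  "carrier (transport_module e d M) = e ` carrier M"
  "\<zero>\<^bsub>transport_module e d M\<^esub> = e \<zero>\<^bsub>M\<^esub>"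
  "x \<oplus>\<^bsub>transport_module e d M\<^esub> y = e (d x \<oplus>\<^bsub>M\<^esub> d y)"
  "a \<odot>\<^bsub>transport_module e d M\<^esub> x = e (a \<odot>\<^bsub>M\<^esub> d x)"
  by (simp_all add: transport_module_def)

lemma module_transport_module:
  assumes "module A M" and d: "\<And>x. x \<in> carrier M \<Longrightarrow> d (e x) = x"
  shows "module A (transport_module e d M)"
proof -
  interpret module A M by fact
  have "abelian_group (transport_module e d M)"
    by (rule abelian_groupI) (auto simp: d M.a_ac M.r_neg intro!: bexI [of _ "\<ominus>\<^bsub>M\<^esub> x" for x])
  then show ?thesis
    by (intro moduleI R.cring_axioms) (auto simp: d smult_l_distr smult_r_distr smult_assoc1)
qed

lemma tensor_relators_add_left:
  "x \<in> carrier M \<Longrightarrow> x' \<in> carrier M \<Longrightarrow> y \<in> carrier N \<Longrightarrow>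
    frag_of (x \<oplus>\<^bsub>M\<^esub> x', y) - frag_of (x, y) - frag_of (x', y) \<in> tensor_relators A M N"
  unfolding tensor_relators_def by blast

lemma tensor_relators_smult:
  "a \<in> carrier A \<Longrightarrow> x \<in> carrier M \<Longrightarrow> y \<in> carrier N \<Longrightarrow>
    frag_of (a \<odot>\<^bsub>M\<^esub> x, y) - frag_of (x, a \<odot>\<^bsub>N\<^esub> y) \<in> tensor_relators A M N"
  unfolding tensor_relators_def by blast

lemma keys_diff_subset:
  fixes u v :: "'a \<Rightarrow>\<^sub>0 int"
  shows "Poly_Mapping.keys u \<subseteq> T \<Longrightarrow> Poly_Mapping.keys v \<subseteq> T \<Longrightarrow> Poly_Mapping.keys (u - v) \<subseteq> T"
  using keys_diff [of u v] by blast

lemma tensor_relators_subset: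
  assumes "module A M" "module A N"
  shows "tensor_relators A M N \<subseteq> carrier (free_Abelian_group (carrier M \<times> carrier N))"
proof -
  interpret M: module A M by fact
  interpret N: module A N by fact
  show ?thesis
  proof (rule subsetI)
    fix u
    assume "u \<in> tensor_relators A M N"
    then show "u \<in> carrier (free_Abelian_group (carrier M \<times> carrier N))"
      unfolding tensor_relators_def carrier_free_Abelian_group_iff
      by (elim UnE CollectE exE conjE; hypsubst; intro keys_diff_subset; simp)
  qed
qed

lemma subgroup_tensor_kernel:
  assumes "module A M" "module A N"
  shows "subgroup (tensor_kernel A M N) (free_Abelian_group (carrier M \<times> carrier N))"
  unfolding tensor_kernel_def
  by (rule group.generate_is_subgroup [OF group_free_Abelian_group tensor_relators_subset [OF assms]])

lemma tensor_kernel_closed: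
  assumes "module A M" "module A N"
  shows "0 \<in> tensor_kernel A M N"
    and "u \<in> tensor_kernel A M N \<Longrightarrow> v \<in> tensor_kernel A M N \<Longrightarrow> u + v \<in> tensor_kernel A M N"
    and "u \<in> tensor_kernel A M N \<Longrightarrow> - u \<in> tensor_kernel A M N"
    and "u \<in> tensor_kernel A M N \<Longrightarrow> v \<in> tensor_kernel A M N \<Longrightarrow> u - v \<in> tensor_kernel A M N"
    and "u \<in> tensor_relators A M N \<Longrightarrow> u \<in> tensor_kernel A M N"
    and "u \<in> tensor_kernel A M N \<Longrightarrow> Poly_Mapping.keys u \<subseteq> carrier M \<times> carrier N"
proof -
  interpret subgroup "tensor_kernel A M N" "free_Abelian_group (carrier M \<times> carrier N)"
    by (rule subgroup_tensor_kernel [OF assms])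
  show "0 \<in> tensor_kernel A M N"
    using one_closed by simp
  show plus: "u \<in> tensor_kernel A M N \<Longrightarrow> v \<in> tensor_kernel A M N \<Longrightarrow> u + v \<in> tensor_kernel A M N" for u v
    using m_closed by simp
  show keys: "u \<in> tensor_kernel A M N \<Longrightarrow> Poly_Mapping.keys u \<subseteq> carrier M \<times> carrier N" for u
    using mem_carrier by simp
  show minus: "u \<in> tensor_kernel A M N \<Longrightarrow> - u \<in> tensor_kernel A M N" for u
    using m_inv_closed keys by (metis inv_free_Abelian_group)
  show "u \<in> tensor_kernel A M N \<Longrightarrow> v \<in> tensor_kernel A M N \<Longrightarrow> u - v \<in> tensor_kernel A M N"
    using plus minus by (metis diff_conv_add_uminus)
  show "u \<in> tensor_relators A M N \<Longrightarrow> u \<in> tensor_kernel A M N"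
    unfolding tensor_kernel_def by (rule generate.incl)
qed

lemma tensor_kernel_induct [consumes 3, case_names relator zero add minus]:
  assumes mod: "module A M" "module A N" and z: "z \<in> tensor_kernel A M N"
    and relator: "\<And>u. u \<in> tensor_relators A M N \<Longrightarrow> Q u"
    and zero: "Q 0" and add: "\<And>u v. u \<in> tensor_kernel A M N \<Longrightarrow> v \<in> tensor_kernel A M N \<Longrightarrow> Q u \<Longrightarrow> Q v \<Longrightarrow> Q (u + v)"
    and minus: "\<And>u. u \<in> tensor_kernel A M N \<Longrightarrow> Q u \<Longrightarrow> Q (- u)"
  shows "Q z"
  using z unfolding tensor_kernel_def
proof (induction rule: generate.induct)
  case one
  then show ?case using zero by simp
next
  case (incl u)
  then show ?case by (rule relator)
next
  case (inv u)
  moreover have "inv\<^bsub>free_Abelian_group (carrier M \<times> carrier N)\<^esub> u = - u"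
    using subsetD [OF tensor_relators_subset [OF mod] inv] by (intro inv_free_Abelian_group) simp
  ultimately show ?case
    using relator minus [of u] tensor_kernel_closed(5) [OF mod] by simp
next
  case (eng u v)
  then show ?case
    using add by (simp add: tensor_kernel_def)
qed

definition frag_map_snd :: "('n0 \<Rightarrow> 'n) \<Rightarrow> ('m \<times> 'n0 \<Rightarrow>\<^sub>0 int) \<Rightarrow> ('m \<times> 'n \<Rightarrow>\<^sub>0 int)" where
  "frag_map_snd f = frag_extend (\<lambda>(x, y). frag_of (x, f y))"

lemma frag_map_snd_simps [simp]:
  "frag_map_snd f 0 = 0"
  "frag_map_snd f (u + v) = frag_map_snd f u + frag_map_snd f v"
  "frag_map_snd f (u - v) = frag_map_snd f u - frag_map_snd f v"
  "frag_map_snd f (- u) = - frag_map_snd f u"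
  "frag_map_snd f (frag_of (x, y)) = frag_of (x, f y)"
  by (simp_all add: frag_map_snd_def frag_extend_add frag_extend_diff frag_extend_minus)

text \<open>A linear map sends relators to relators. This is why \<open>tensor_map\<close> does not
  depend on the representative of a coset.\<close>

lemma frag_map_snd_tensor_kernel:
  assumes mod: "module A M" "module A N" "module A N'"
    and closed: "\<And>y. y \<in> carrier N \<Longrightarrow> f y \<in> carrier N'"
    and add: "\<And>y y'. y \<in> carrier N \<Longrightarrow> y' \<in> carrier N \<Longrightarrow> f (y \<oplus>\<^bsub>N\<^esub> y') = f y \<oplus>\<^bsub>N'\<^esub> f y'"
    and smult: "\<And>a y. a \<in> carrier A \<Longrightarrow> y \<in> carrier N \<Longrightarrow> f (a \<odot>\<^bsub>N\<^esub> y) = a \<odot>\<^bsub>N'\<^esub> f y"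
    and z: "z \<in> tensor_kernel A M N"
  shows "frag_map_snd f z \<in> tensor_kernel A M N'"
  using mod(1,2) z
proof (induction rule: tensor_kernel_induct)
  case (relator u)
  have "frag_map_snd f u \<in> tensor_relators A M N'"
    using relator unfolding tensor_relators_def
    by (elim UnE CollectE exE conjE; simp only: frag_map_snd_simps add smult; insert closed; blast)
  then show ?case
    by (rule tensor_kernel_closed(5) [OF mod(1,3)])
qed (simp_all add: tensor_kernel_closed [OF mod(1,3)])

text \<open>Purity restated on formal sums. The cosets of \<open>z\<close> and of 0 both go to the
  zero coset, so injectivity identifies them.\<close>

lemma pure_map_tensor_kernel:
  fixes M :: "('a, 'm) module"
  assumes pure: "pure_map TYPE('m) A N N' f"
    and mod: "module A M" "module A N" "module A N'"
    and closed: "\<And>y. y \<in> carrier N \<Longrightarrow> f y \<in> carrier N'"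
    and add: "\<And>y y'. y \<in> carrier N \<Longrightarrow> y' \<in> carrier N \<Longrightarrow> f (y \<oplus>\<^bsub>N\<^esub> y') = f y \<oplus>\<^bsub>N'\<^esub> f y'"
    and smult: "\<And>a y. a \<in> carrier A \<Longrightarrow> y \<in> carrier N \<Longrightarrow> f (a \<odot>\<^bsub>N\<^esub> y) = a \<odot>\<^bsub>N'\<^esub> f y"
    and z: "Poly_Mapping.keys z \<subseteq> carrier M \<times> carrier N"
    and fz: "frag_map_snd f z \<in> tensor_kernel A M N'"
  shows "z \<in> tensor_kernel A M N"
proof -
  let ?G = "free_Abelian_group (carrier M \<times> carrier N)"
  let ?G' = "free_Abelian_group (carrier M \<times> carrier N')"
  let ?K = "tensor_kernel A M N" and ?K' = "tensor_kernel A M N'"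
  have coset: "?K #>\<^bsub>?G\<^esub> u = {k + u | k. k \<in> ?K}" for u
    unfolding r_coset_def by auto
  have map: "tensor_map A M N' f (?K #>\<^bsub>?G\<^esub> u) = ?K'" if u: "frag_map_snd f u \<in> ?K'" for u
  proof -
    have "?K' #>\<^bsub>?G'\<^esub> frag_map_snd f (k + u) = ?K'" if "k \<in> ?K" for k
    proof (rule group.coset_join2 [OF group_free_Abelian_group _ subgroup_tensor_kernel [OF mod(1,3)]])
      show in_K': "frag_map_snd f (k + u) \<in> ?K'"
        using frag_map_snd_tensor_kernel [OF mod closed add smult that] u
        by (simp add: tensor_kernel_closed [OF mod(1,3)])
      show "frag_map_snd f (k + u) \<in> carrier ?G'"
        using tensor_kernel_closed(6) [OF mod(1,3) in_K'] by simp
    qed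
    then have "(\<Union>v\<in>{k + u | k. k \<in> ?K}. ?K' #>\<^bsub>?G'\<^esub> frag_map_snd f v) = ?K'"
      using tensor_kernel_closed(1) [OF mod(1,2)] by (auto simp del: frag_map_snd_simps)
    then show ?thesis
      unfolding tensor_map_def coset frag_map_snd_def by simp
  qed
  have "inj_on (tensor_map A M N' f) (carrier (tensor_product A M N))"
    using pure mod(1) unfolding pure_map_def by blast
  moreover have "?K #>\<^bsub>?G\<^esub> u \<in> carrier (tensor_product A M N)"
    if "Poly_Mapping.keys u \<subseteq> carrier M \<times> carrier N" for u
    unfolding tensor_product_def FactGroup_def RCOSETS_def using that by auto
  ultimately have "?K #>\<^bsub>?G\<^esub> z = ?K #>\<^bsub>?G\<^esub> 0"
    using map [OF fz] map [of 0] z tensor_kernel_closed(1) [OF mod(1,3)]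
    by (auto dest!: inj_onD [of _ _ "?K #>\<^bsub>?G\<^esub> z" "?K #>\<^bsub>?G\<^esub> 0"])
  moreover have "z \<in> ?K #>\<^bsub>?G\<^esub> z"
    unfolding coset using tensor_kernel_closed(1) [OF mod(1,2)] by force
  ultimately show ?thesis
    by (auto simp: coset)
qed

text \<open>The witness is the scalar multiplication \<open>M \<otimes> A \<rightarrow> M\<close>.\<close>

lemma smult_eq_0_if_tensor_kernel:
  assumes "module A M" "x \<in> carrier M" "a \<in> carrier A"
    and z: "frag_of (x, a) \<in> tensor_kernel A M (module_along (\<lambda>a. a) A)"
  shows "a \<odot>\<^bsub>M\<^esub> x = \<zero>\<^bsub>M\<^esub>"
proof -
  interpret module A M by fact
  let ?N = "module_along (\<lambda>a. a) A"
  let ?G = "free_Abelian_group (carrier M \<times> carrier ?N)"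
  have N: "module A ?N"
    by (rule module_module_along [OF R.cring_axioms R.ring_axioms]) (simp add: ring_hom_def)
  obtain h where h: "h \<in> hom ?G (add_monoid M)"
    "\<And>u. u \<in> carrier M \<times> carrier ?N \<Longrightarrow> h (frag_of u) = snd u \<odot>\<^bsub>M\<^esub> fst u"
  proof (rule comm_group.free_Abelian_group_universal [OF M.a_comm_group])
    show "(\<lambda>u. snd u \<odot>\<^bsub>M\<^esub> fst u) ` (carrier M \<times> carrier ?N) \<subseteq> carrier (add_monoid M)"
      by auto
  qed (rule that)
  interpret h: group_hom ?G "add_monoid M" h
    using h(1) M.a_group by (simp add: group_hom_def group_hom_axioms_def)
  have h_add: "h (u + v) = h u \<oplus>\<^bsub>M\<^esub> h v"
    if "Poly_Mapping.keys u \<subseteq> carrier M \<times> carrier A" "Poly_Mapping.keys v \<subseteq> carrier M \<times> carrier A" for u v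
    using h.hom_mult [of u v] that by simp
  have h_minus: "h (- u) = \<ominus>\<^bsub>M\<^esub> h u" if "Poly_Mapping.keys u \<subseteq> carrier M \<times> carrier A" for u
    using h.hom_inv [of u] that by (simp add: a_inv_def)
  have h_diff: "h (u - v) = h u \<ominus>\<^bsub>M\<^esub> h v"
    if "Poly_Mapping.keys u \<subseteq> carrier M \<times> carrier A" "Poly_Mapping.keys v \<subseteq> carrier M \<times> carrier A" for u v
    using h_add [of u "- v"] h_minus [of v] that by (simp add: a_minus_def)
  have h_of: "h (frag_of (y, b)) = b \<odot>\<^bsub>M\<^esub> y" if "y \<in> carrier M" "b \<in> carrier A" for y b
    using h(2) [of "(y, b)"] that by simp
  have "h z = \<zero>\<^bsub>M\<^esub>" if "z \<in> tensor_kernel A M ?N" for z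
    using assms(1) N that
  proof (induction rule: tensor_kernel_induct)
    case (relator u)
    then show ?case
      unfolding tensor_relators_def
    proof (elim UnE CollectE exE conjE)
      fix y y' b
      assume "u = frag_of (y \<oplus>\<^bsub>M\<^esub> y', b) - frag_of (y, b) - frag_of (y', b)"
        and *: "y \<in> carrier M" "y' \<in> carrier M" "b \<in> carrier ?N"
      then have "h u = (b \<odot>\<^bsub>M\<^esub> (y \<oplus>\<^bsub>M\<^esub> y') \<ominus>\<^bsub>M\<^esub> b \<odot>\<^bsub>M\<^esub> y) \<ominus>\<^bsub>M\<^esub> b \<odot>\<^bsub>M\<^esub> y'"
        by (simp add: h_diff h_of keys_diff_subset)
      also have "\<dots> = \<zero>\<^bsub>M\<^esub>"
        using * by (simp add: smult_r_distr a_minus_def M.a_ac M.r_neg M.r_neg1)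
      finally show ?thesis .
    next
      fix y b b'
      assume "u = frag_of (y, b \<oplus>\<^bsub>?N\<^esub> b') - frag_of (y, b) - frag_of (y, b')"
        and *: "y \<in> carrier M" "b \<in> carrier ?N" "b' \<in> carrier ?N"
      then have "h u = ((b \<oplus>\<^bsub>A\<^esub> b') \<odot>\<^bsub>M\<^esub> y \<ominus>\<^bsub>M\<^esub> b \<odot>\<^bsub>M\<^esub> y) \<ominus>\<^bsub>M\<^esub> b' \<odot>\<^bsub>M\<^esub> y"
        by (simp add: h_diff h_of keys_diff_subset)
      also have "\<dots> = \<zero>\<^bsub>M\<^esub>"
        using * by (simp add: smult_l_distr a_minus_def M.a_ac M.r_neg M.r_neg1)
      finally show ?thesis .
    next
      fix c y b
      assume "u = frag_of (c \<odot>\<^bsub>M\<^esub> y, b) - frag_of (y, c \<odot>\<^bsub>?N\<^esub> b)"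
        and *: "c \<in> carrier A" "y \<in> carrier M" "b \<in> carrier ?N"
      then have "h u = b \<odot>\<^bsub>M\<^esub> (c \<odot>\<^bsub>M\<^esub> y) \<ominus>\<^bsub>M\<^esub> (c \<otimes>\<^bsub>A\<^esub> b) \<odot>\<^bsub>M\<^esub> y"
        by (simp add: h_diff h_of)
      also have "\<dots> = \<zero>\<^bsub>M\<^esub>"
        using * by (simp add: smult_assoc1 [symmetric] R.m_comm a_minus_def M.r_neg)
      finally show ?thesis .
    qed
  next
    case zero
    then show ?case
      using h.hom_one by simp
  next
    case (add u v)
    then show ?case
      using h_add [of u v] tensor_kernel_closed(6) [OF assms(1) N] by simp
  next
    case (minus u)
    then show ?case
      using h_minus [of u] tensor_kernel_closed(6) [OF assms(1) N] by simp
  qed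
  then show ?thesis
    using z h_of assms by metis
qed

text \<open>Test purity on \<open>M = A/(x)\<close>: the Frobenius sends \<open>1 \<otimes> a\<close> to \<open>1 \<otimes> c x\<^sup>p = x \<otimes> c = 0\<close>.\<close>

lemma F_pure_principal_ideal:
  fixes A :: "('a, 'c) ring_scheme" (structure)
  assumes "cring A" "F_pure p A" and frob: "frobenius p A \<in> ring_hom A A"
    and x: "x \<in> carrier A" and a: "a \<in> carrier A" "a [^] p \<in> PIdl (x [^] p)"
  shows "a \<in> PIdl x"
proof -
  interpret A: cring A by fact
  let ?I = "PIdl x"
  interpret I: ideal ?I A
    using x by (rule A.cgenideal_ideal)
  interpret Q: cring "A Quot ?I"
    by (rule I.quotient_is_cring [OF A.cring_axioms])
  \<comment> \<open>A coset is encoded as the set of all sequences whose entry at 0 lies in it;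
    evaluation at 0 decodes it.\<close>
  define e :: "'a set \<Rightarrow> (nat \<Rightarrow> 'a) set" where "e C = {f. f 0 \<in> C}" for C
  define d :: "(nat \<Rightarrow> 'a) set \<Rightarrow> 'a set" where "d D = (\<lambda>f. f 0) ` D" for D
  have de [simp]: "d (e C) = C" for C
    unfolding d_def e_def by (force intro: image_eqI [of _ _ "\<lambda>_. c" for c])
  define M0 where "M0 = module_along ((+>) ?I) (A Quot ?I)"
  define M where "M = transport_module e d M0"
  let ?N = "module_along (\<lambda>a. a) A" and ?N' = "module_along (frobenius p A) A"
  have M: "module A M"
    unfolding M_def M0_def
    by (intro module_transport_module module_module_along A.cring_axioms Q.ring_axioms I.rcos_ring_hom) simp
  have N: "module A ?N" "module A ?N'"
    using frob by (auto intro!: module_module_along A.cring_axioms A.ring_axioms simp: ring_hom_def)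
  interpret M: module A M by fact
  let ?m = "e (?I +> \<one>)"
  have m: "?m \<in> carrier M"
    by (auto simp: M_def M0_def FactRing_def A_RCOSETS_def')
  have smult_m: "b \<odot>\<^bsub>M\<^esub> ?m = e (?I +> b)" if "b \<in> carrier A" for b
    using that by (simp add: M_def M0_def FactRing_def I.rcoset_mult_add)
  have zero: "\<zero>\<^bsub>M\<^esub> = e ?I"
    by (simp add: M_def M0_def FactRing_def)
  have "x \<in> ?I"
    using x by (rule A.cgenideal_self)
  then have xm: "x \<odot>\<^bsub>M\<^esub> ?m = \<zero>\<^bsub>M\<^esub>"
    using x by (simp add: smult_m zero I.a_rcos_const)
  obtain c where c: "c \<in> carrier A" "a [^] p = c \<otimes> x [^] p"
    using a(2) unfolding cgenideal_def by auto
  \<comment> \<open>On the target of Frobenius, \<open>x\<close> acts as its p-th power, so moving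
    \<open>x\<close> across the tensor sign yields a^p.\<close>
  have "x \<odot>\<^bsub>?N'\<^esub> c = a [^] p"
    using x c by (simp add: frobenius_def A.m_comm)
  then have "frag_of (\<zero>\<^bsub>M\<^esub>, c) - frag_of (?m, a [^] p) \<in> tensor_kernel A M ?N'"
    using tensor_relators_smult [of x A ?m M c ?N'] x m c(1)
    by (intro tensor_kernel_closed(5) [OF M N(2)]) (simp only: xm module_along_simps(1))
  \<comment> \<open>The relator for 0 + 0 in the first argument collapses to this term: the tensor
    of 0 and \<open>c\<close> is zero.\<close>
  moreover have "- frag_of (\<zero>\<^bsub>M\<^esub>, c) \<in> tensor_kernel A M ?N'"
    using tensor_relators_add_left [of "\<zero>\<^bsub>M\<^esub>" M "\<zero>\<^bsub>M\<^esub>" c ?N' A] c(1)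
    by (intro tensor_kernel_closed(5) [OF M N(2)]) simp
  ultimately have "- (- frag_of (\<zero>\<^bsub>M\<^esub>, c) + (frag_of (\<zero>\<^bsub>M\<^esub>, c) - frag_of (?m, a [^] p))) \<in> tensor_kernel A M ?N'"
    using tensor_kernel_closed(3) [OF M N(2) tensor_kernel_closed(2) [OF M N(2)]] by blast
  then have "frag_map_snd (frobenius p A) (frag_of (?m, a)) \<in> tensor_kernel A M ?N'"
    by (simp add: frobenius_def)
  then have "frag_of (?m, a) \<in> tensor_kernel A M ?N"
    using assms(2) unfolding F_pure_def
    by (rule pure_map_tensor_kernel [OF _ M N, rotated -1])
      (use frob m a in \<open>auto simp: ring_hom_def\<close>)
  then have "a \<odot>\<^bsub>M\<^esub> ?m = \<zero>\<^bsub>M\<^esub>"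
    by (rule smult_eq_0_if_tensor_kernel [OF M m a(1)])
  then have "?I +> a = ?I"
    using a(1) de by (metis smult_m zero)
  then show ?thesis
    using I.a_rcos_self [OF a(1)] by simp
qed

subsection \<open>Localization\<close>

locale mult_subset = cring A for A (structure) +
  fixes W
  assumes W_subset: "W \<subseteq> carrier A"
    and one_mem: "\<one> \<in> W"
    and mult_mem: "s \<in> W \<Longrightarrow> t \<in> W \<Longrightarrow> s \<otimes> t \<in> W"
begin

abbreviation "L \<equiv> localization A W"
abbreviation "frc \<equiv> fraction A W"

lemma W_carrier [simp]: "s \<in> W \<Longrightarrow> s \<in> carrier A"
  using W_subset by blast

lemma equiv_loc_rel: "equiv (carrier A \<times> W) (loc_rel A W)"
proof (rule equivI)
  show "loc_rel A W \<subseteq> (carrier A \<times> W) \<times> (carrier A \<times> W)"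
    by (auto simp: loc_rel_def)
  show "refl_on (carrier A \<times> W) (loc_rel A W)"
    using one_mem by (auto simp: refl_on_def loc_rel_def)
  show "sym (loc_rel A W)"
    by (rule symI) (auto simp: loc_rel_def dest: sym)
  show "trans (loc_rel A W)"
  proof (rule transI)
    fix x y z
    assume "(x, y) \<in> loc_rel A W" "(y, z) \<in> loc_rel A W"
    then obtain a s b t c r u v where
      eq: "x = (a, s)" "y = (b, t)" "z = (c, r)" and
      mem: "a \<in> carrier A" "s \<in> W" "b \<in> carrier A" "t \<in> W" "c \<in> carrier A" "r \<in> W" "u \<in> W" "v \<in> W" and
      u: "u \<otimes> (t \<otimes> a) = u \<otimes> (s \<otimes> b)" and v: "v \<otimes> (r \<otimes> b) = v \<otimes> (t \<otimes> c)"
      unfolding loc_rel_def by blast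
    \<comment> \<open>The witness for transitivity is u v t: the first relation is multiplied by v
      r, the second by u s.\<close>
    have "(u \<otimes> v \<otimes> t) \<otimes> (r \<otimes> a) = (v \<otimes> r) \<otimes> (u \<otimes> (t \<otimes> a))"
      using mem by (simp add: m_ac)
    also have "\<dots> = (u \<otimes> s) \<otimes> (v \<otimes> (r \<otimes> b))"
      using mem unfolding u by (simp add: m_ac)
    also have "\<dots> = (u \<otimes> v \<otimes> t) \<otimes> (s \<otimes> c)"
      using mem unfolding v by (simp add: m_ac)
    finally show "(x, z) \<in> loc_rel A W"
      unfolding loc_rel_def eq using mem mult_mem by blast
  qed
qed

lemma frac_eq_iff:
  assumes "a \<in> carrier A" "s \<in> W" "b \<in> carrier A" "t \<in> W"
  shows "frc a s = frc b t \<longleftrightarrow> (\<exists>u\<in>W. u \<otimes> (t \<otimes> a) = u \<otimes> (s \<otimes> b))"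
  unfolding fraction_def using assms
  by (subst eq_equiv_class_iff [OF equiv_loc_rel]) (auto simp: loc_rel_def)

lemma frac_eqI:
  assumes "a \<in> carrier A" "s \<in> W" "b \<in> carrier A" "t \<in> W" "t \<otimes> a = s \<otimes> b"
  shows "frc a s = frc b t"
  using assms one_mem by (subst frac_eq_iff) auto

lemma frac_mem_iff:
  "(b, t) \<in> frc a s \<longleftrightarrow> b \<in> carrier A \<and> t \<in> W \<and> a \<in> carrier A \<and> s \<in> W \<and>
    (\<exists>u\<in>W. u \<otimes> (t \<otimes> a) = u \<otimes> (s \<otimes> b))"
  unfolding fraction_def loc_rel_def by auto

lemma frac_self: "a \<in> carrier A \<Longrightarrow> s \<in> W \<Longrightarrow> (a, s) \<in> frc a s"
  unfolding frac_mem_iff using one_mem by blast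

lemma carrier_L: "carrier L = {frc a s | a s. a \<in> carrier A \<and> s \<in> W}"
  unfolding localization_def quotient_def fraction_def by auto

lemma frac_closed [simp]: "a \<in> carrier A \<Longrightarrow> s \<in> W \<Longrightarrow> frc a s \<in> carrier L"
  unfolding carrier_L by blast

lemma carrier_LE:
  assumes "x \<in> carrier L"
  obtains a s where "x = frc a s" "a \<in> carrier A" "s \<in> W"
  using assms unfolding carrier_L by blast

text \<open>The product in \<open>localization\<close> is a union over representatives. It collapses
  because every pair of representatives gives the same class; \<open>add_frac\<close> follows the
  same pattern.\<close>

lemma mult_frac:
  assumes "a \<in> carrier A" "s \<in> W" "b \<in> carrier A" "t \<in> W"
  shows "frc a s \<otimes>\<^bsub>L\<^esub> frc b t = frc (a \<otimes> b) (s \<otimes> t)"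
proof -
  have "frc (a' \<otimes> b') (s' \<otimes> t') = frc (a \<otimes> b) (s \<otimes> t)"
    if *: "(a', s') \<in> frc a s" "(b', t') \<in> frc b t" for a' s' b' t'
  proof -
    obtain u v where mem: "a' \<in> carrier A" "s' \<in> W" "b' \<in> carrier A" "t' \<in> W" "u \<in> W" "v \<in> W" and
      u: "u \<otimes> (s' \<otimes> a) = u \<otimes> (s \<otimes> a')" and v: "v \<otimes> (t' \<otimes> b) = v \<otimes> (t \<otimes> b')"
      using * unfolding frac_mem_iff by blast
    have "(u \<otimes> v) \<otimes> ((s \<otimes> t) \<otimes> (a' \<otimes> b')) = (u \<otimes> (s \<otimes> a')) \<otimes> (v \<otimes> (t \<otimes> b'))"
      using mem assms by (simp add: m_ac)
    also have "\<dots> = (u \<otimes> v) \<otimes> ((s' \<otimes> t') \<otimes> (a \<otimes> b))"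
      using mem assms unfolding u [symmetric] v [symmetric] by (simp add: m_ac)
    finally show ?thesis
      using mem assms mult_mem by (subst frac_eq_iff) auto
  qed
  then have "(\<Union>(a', s')\<in>frc a s. \<Union>(b', t')\<in>frc b t. frc (a' \<otimes> b') (s' \<otimes> t')) = frc (a \<otimes> b) (s \<otimes> t)"
    using frac_self [OF assms(1,2)] frac_self [OF assms(3,4)] by fast
  then show ?thesis
    by (simp add: localization_def)
qed

lemma add_frac:
  assumes "a \<in> carrier A" "s \<in> W" "b \<in> carrier A" "t \<in> W"
  shows "frc a s \<oplus>\<^bsub>L\<^esub> frc b t = frc ((t \<otimes> a) \<oplus> (s \<otimes> b)) (s \<otimes> t)"
proof -
  have "frc ((t' \<otimes> a') \<oplus> (s' \<otimes> b')) (s' \<otimes> t') = frc ((t \<otimes> a) \<oplus> (s \<otimes> b)) (s \<otimes> t)"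
    if *: "(a', s') \<in> frc a s" "(b', t') \<in> frc b t" for a' s' b' t'
  proof -
    obtain u v where mem: "a' \<in> carrier A" "s' \<in> W" "b' \<in> carrier A" "t' \<in> W" "u \<in> W" "v \<in> W" and
      u: "u \<otimes> (s' \<otimes> a) = u \<otimes> (s \<otimes> a')" and v: "v \<otimes> (t' \<otimes> b) = v \<otimes> (t \<otimes> b')"
      using * unfolding frac_mem_iff by blast
    have "(u \<otimes> v) \<otimes> ((s \<otimes> t) \<otimes> ((t' \<otimes> a') \<oplus> (s' \<otimes> b'))) =
      (v \<otimes> t \<otimes> t') \<otimes> (u \<otimes> (s \<otimes> a')) \<oplus> (u \<otimes> s \<otimes> s') \<otimes> (v \<otimes> (t \<otimes> b'))"
      using mem assms by (simp add: m_ac r_distr)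
    also have "\<dots> = (u \<otimes> v) \<otimes> ((s' \<otimes> t') \<otimes> ((t \<otimes> a) \<oplus> (s \<otimes> b)))"
      using mem assms unfolding u [symmetric] v [symmetric] by (simp add: m_ac r_distr)
    finally show ?thesis
      using mem assms mult_mem by (subst frac_eq_iff) auto
  qed
  then have "(\<Union>(a', s')\<in>frc a s. \<Union>(b', t')\<in>frc b t. frc ((t' \<otimes> a') \<oplus> (s' \<otimes> b')) (s' \<otimes> t')) =
    frc ((t \<otimes> a) \<oplus> (s \<otimes> b)) (s \<otimes> t)"
    using frac_self [OF assms(1,2)] frac_self [OF assms(3,4)] by fast
  then show ?thesis
    by (simp add: localization_def)
qed

lemma zero_L: "\<zero>\<^bsub>L\<^esub> = frc \<zero> \<one>"
  by (simp add: localization_def)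

lemma one_L: "\<one>\<^bsub>L\<^esub> = frc \<one> \<one>"
  by (simp add: localization_def)

lemma abelian_group_L: "abelian_group L"
proof (rule abelian_groupI)
  fix x y z
  assume "x \<in> carrier L" "y \<in> carrier L" "z \<in> carrier L"
  then obtain a s b t c r where
    eq: "x = frc a s" "y = frc b t" "z = frc c r" and
    mem: "a \<in> carrier A" "s \<in> W" "b \<in> carrier A" "t \<in> W" "c \<in> carrier A" "r \<in> W"
    by (metis carrier_LE)
  show "x \<oplus>\<^bsub>L\<^esub> y \<in> carrier L"
    using mem by (simp add: eq add_frac mult_mem)
  show "x \<oplus>\<^bsub>L\<^esub> y \<oplus>\<^bsub>L\<^esub> z = x \<oplus>\<^bsub>L\<^esub> (y \<oplus>\<^bsub>L\<^esub> z)"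
    using mem by (simp add: eq add_frac mult_mem m_ac a_ac r_distr)
next
  fix x y
  assume "x \<in> carrier L" "y \<in> carrier L"
  then obtain a s b t where
    eq: "x = frc a s" "y = frc b t" and
    mem: "a \<in> carrier A" "s \<in> W" "b \<in> carrier A" "t \<in> W"
    by (metis carrier_LE)
  then show "x \<oplus>\<^bsub>L\<^esub> y = y \<oplus>\<^bsub>L\<^esub> x"
    by (simp add: eq add_frac m_comm a_comm)
next
  fix x
  assume "x \<in> carrier L"
  then obtain a s where eq: "x = frc a s" and mem: "a \<in> carrier A" "s \<in> W"
    by (rule carrier_LE)
  then show "\<zero>\<^bsub>L\<^esub> \<oplus>\<^bsub>L\<^esub> x = x"
    by (simp add: eq zero_L add_frac one_mem)
  have "frc (\<ominus> a) s \<oplus>\<^bsub>L\<^esub> x = frc \<zero> (s \<otimes> s)"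
    using mem by (simp add: eq add_frac r_minus l_neg)
  also have "\<dots> = \<zero>\<^bsub>L\<^esub>"
    unfolding zero_L using mem by (intro frac_eqI) (auto simp: mult_mem one_mem)
  finally show "\<exists>y\<in>carrier L. y \<oplus>\<^bsub>L\<^esub> x = \<zero>\<^bsub>L\<^esub>"
    using mem by (intro bexI [of _ "frc (\<ominus> a) s"]) auto
qed (simp add: zero_L one_mem)

lemma pow_mem: "s \<in> W \<Longrightarrow> s [^] (n::nat) \<in> W"
  by (induction n) (auto simp: one_mem mult_mem)

lemma frobenius_frac:
  assumes "a \<in> carrier A" "s \<in> W"
  shows "frobenius p L (frc a s) = frc (a [^] p) (s [^] p)"
proof -
  have "frc a s [^]\<^bsub>L\<^esub> p = frc (a [^] p) (s [^] p)"
    using assms by (induction p) (simp_all add: one_L mult_frac pow_mem)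
  then show ?thesis
    by (simp add: frobenius_def)
qed

end

lemma loc_map_fraction:
  assumes "mult_subset A W" "mult_subset A W'" "W \<subseteq> W'" "a \<in> carrier A" "s \<in> W"
  shows "loc_map A W' (fraction A W a s) = fraction A W' a s"
proof -
  interpret W: mult_subset A W by fact
  interpret W': mult_subset A W' by fact
  have "fraction A W' b t = fraction A W' a s" if "(b, t) \<in> fraction A W a s" for b t
    using that assms(3-5) unfolding W.frac_mem_iff
    by (subst W'.frac_eq_iff) (auto dest: sym)
  then show ?thesis
    unfolding loc_map_def using W.frac_self [OF assms(4,5)] by fast
qed

section \<open>Denominators in the Cech complex\<close>

context cring
begin

lemma mult_subset_cech_loc:
  assumes J: "\<And>j. j \<in> J \<Longrightarrow> xs ! j \<in> carrier R"
  shows "mult_subset R (cech_loc R xs J)"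
proof unfold_locales
  show "cech_loc R xs J \<subseteq> carrier R"
    unfolding cech_loc_def using J by (auto intro!: finprod_closed)
  have "\<one> = (\<Otimes>j\<in>J. (xs ! j) [^] (0::nat))"
    by simp
  then show "\<one> \<in> cech_loc R xs J"
    unfolding cech_loc_def by (intro image_eqI [of _ _ "\<lambda>_. 0"]) auto
  fix s t
  assume "s \<in> cech_loc R xs J" "t \<in> cech_loc R xs J"
  then obtain d e :: "nat \<Rightarrow> nat"
    where st: "s = (\<Otimes>j\<in>J. (xs ! j) [^] d j)" "t = (\<Otimes>j\<in>J. (xs ! j) [^] e j)"
    unfolding cech_loc_def by blast
  have "s \<otimes> t = (\<Otimes>j\<in>J. (xs ! j) [^] d j \<otimes> (xs ! j) [^] e j)"
    unfolding st using J by (intro finprod_multf [symmetric]) auto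
  also have "\<dots> = (\<Otimes>j\<in>J. (xs ! j) [^] (d j + e j))"
    using J by (intro finprod_cong') (auto simp: nat_pow_mult)
  finally show "s \<otimes> t \<in> cech_loc R xs J"
    unfolding cech_loc_def by (intro image_eqI [of _ _ "\<lambda>j. d j + e j"]) auto
qed

lemma cech_loc_mono:
  assumes "finite J" "I \<subseteq> J" "\<And>j. j \<in> J \<Longrightarrow> xs ! j \<in> carrier R"
  shows "cech_loc R xs I \<subseteq> cech_loc R xs J"
proof
  fix s
  assume "s \<in> cech_loc R xs I"
  then obtain e :: "nat \<Rightarrow> nat" where "s = (\<Otimes>j\<in>I. (xs ! j) [^] e j)"
    unfolding cech_loc_def by blast
  also have "\<dots> = (\<Otimes>j\<in>J. (xs ! j) [^] (if j \<in> I then e j else 0))"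
    using assms by (intro finprod_mono_neutral_cong_left) auto
  finally show "s \<in> cech_loc R xs J"
    unfolding cech_loc_def by (intro image_eqI [of _ _ "\<lambda>j. if j \<in> I then e j else 0"]) auto
qed

lemma cech_loc_empty: "cech_loc R xs {} = {\<one>}"
  unfolding cech_loc_def by auto

lemma cech_loc_singleton:
  "xs ! j \<in> carrier R \<Longrightarrow> cech_loc R xs {j} = range (\<lambda>n::nat. (xs ! j) [^] n)"
  unfolding cech_loc_def by (auto simp: image_iff intro: exI [of _ "\<lambda>_. n" for n])

end

subsection \<open>The cusp ring in characteristic two\<close>

locale cusp_ring = power_series_subring B h
  for B :: "('b, 'c) ring_scheme" (structure) and h :: "'b \<Rightarrow> 'k::field fps" +
  assumes image_h: "h ` carrier B = {f. f $ 1 = 0}"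
    and two_eq_0: "(2::'k) = 0"
begin

text \<open>The coefficient is twice a product. Hence Frobenius maps all of k[[s]] into the image of
  \<open>h\<close>, which is the source of the failure of F-injectivity.\<close>

lemma square_nth_1: "(f ^ 2) $ 1 = (0::'k)" for f :: "'k fps"
proof -
  have "(f ^ 2) $ 1 = 2 * (f $ 0 * f $ 1)"
    by (simp add: power2_eq_square fps_mult_nth mult.commute)
  then show ?thesis
    by (simp add: two_eq_0)
qed

lemma square_add: "(f + g) ^ 2 = f ^ 2 + g ^ 2" for f g :: "'k fps"
proof -
  have "(2::'k fps) = 0"
    by (metis fps_const_0_eq_0 fps_numeral_fps_const two_eq_0)
  then show ?thesis
    by (simp add: power2_sum)
qed

lemma frobenius_hom: "frobenius 2 B \<in> ring_hom B B"
proof (rule ring_hom_memI)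
  fix a b
  assume "a \<in> carrier B" "b \<in> carrier B"
  then show "frobenius 2 B (a \<oplus> b) = frobenius 2 B a \<oplus> frobenius 2 B b"
    unfolding frobenius_def by (intro h_eqI) (simp_all add: square_add)
qed (auto simp: frobenius_def nat_pow_distrib)

lemma not_F_pure: "\<not> F_pure 2 B"
proof
  assume "F_pure 2 B"
  \<comment> \<open>Both sides are s^6; the cofactor s^2 belongs to the ring.\<close>
  have "h (lift fps_X [^] (2::nat)) = h (lift 1 \<otimes> lift 1 [^] (2::nat))"
    by (simp add: power2_eq_square algebra_simps)
  then have "lift fps_X [^] (2::nat) = lift 1 \<otimes> lift 1 [^] (2::nat)"
    by (intro h_eqI) simp_all
  then have "lift fps_X [^] (2::nat) \<in> PIdl (lift 1 [^] (2::nat))"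
    unfolding cgenideal_def by (metis (mono_tags, lifting) lift(1) mem_Collect_eq)
  then have "lift fps_X \<in> PIdl (lift 1)"
    by (rule F_pure_principal_ideal [OF cring_axioms \<open>F_pure 2 B\<close> frobenius_hom lift(1) lift(1)])
  moreover have "fps_X \<notin> h ` carrier B"
    by (simp add: image_h)
  ultimately show False
    using lift_X_notin by blast
qed

definition scale :: "'k fps \<Rightarrow> 'b \<Rightarrow> 'b" where
  "scale g x = elem (g * h x)"

text \<open>For the cusp, a vanishing constant term forces order at least 2. So the maximal ideal is
  all of s^2 k[[s]] and is stable under multiplication by arbitrary series.\<close>

lemma scale:
  assumes "x \<in> pos_ideal"
  shows "scale g x \<in> carrier B" "h (scale g x) = g * h x"
proof -
  have "h x $ 0 = 0" "h x $ 1 = 0"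
    using assms image_h unfolding pos_ideal_def by auto
  then have "g * h x \<in> h ` carrier B"
    unfolding image_h by (simp add: fps_mult_nth)
  then show "scale g x \<in> carrier B" "h (scale g x) = g * h x"
    unfolding scale_def by (rule elem_closed h_elem)+
qed

text \<open>\<open>g \<in> k[[s]]\<close> need not lie in \<open>B\<close>, but it is the fraction \<open>(g x)/x\<close> for every \<open>x\<close> in the
  maximal ideal. This also makes sense for \<open>x = 0\<close>, where the localization is the zero ring.\<close>

definition cochain :: "'b list \<Rightarrow> 'k fps \<Rightarrow> nat set \<Rightarrow> ('b \<times> 'b) set" where
  "cochain xs g = (\<lambda>J\<in>cech_index xs 1.
     fraction B (cech_loc B xs J) (scale g (xs ! the_elem J)) (xs ! the_elem J))"

section \<open>First Cech cohomology on an arbitrary list in the maximal ideal\<close>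

context
  fixes xs
  assumes xs: "set xs \<subseteq> pos_ideal"
begin

lemma nth_pos_ideal: "j < length xs \<Longrightarrow> xs ! j \<in> pos_ideal"
  using xs by auto

lemma nth_closed: "j < length xs \<Longrightarrow> xs ! j \<in> carrier B"
  using nth_pos_ideal by (auto simp: pos_ideal_def)

lemma mult_subset_loc:
  "J \<subseteq> {..<length xs} \<Longrightarrow> mult_subset B (cech_loc B xs J)"
  by (rule mult_subset_cech_loc) (auto intro: nth_closed)

lemma nth_mem_loc:
  assumes "J \<subseteq> {..<length xs}" "j \<in> J"
  shows "xs ! j \<in> cech_loc B xs J"
proof -
  have "xs ! j = (xs ! j) [^] (1::nat)"
    using assms nth_closed [of j] by (auto simp: subset_iff)
  then have "xs ! j \<in> cech_loc B xs {j}"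
    using assms nth_closed [of j] cech_loc_singleton [of xs j] by (metis lessThan_iff rangeI subsetD)
  then show ?thesis
    using assms cech_loc_mono [of J "{j}" xs] finite_subset [OF assms(1)] by (auto intro: nth_closed)
qed

text \<open>Cross-multiplied, both sides are g x_i x_j. This independence of the position is what
  makes \<open>cochain\<close> a cocycle.\<close>

lemma fraction_scale_eq:
  assumes "J \<subseteq> {..<length xs}" "i \<in> J" "j \<in> J"
  shows "fraction B (cech_loc B xs J) (scale g (xs ! i)) (xs ! i) =
    fraction B (cech_loc B xs J) (scale g (xs ! j)) (xs ! j)"
proof -
  interpret W: mult_subset B "cech_loc B xs J"
    by (rule mult_subset_loc) fact
  have ij: "xs ! i \<in> pos_ideal" "xs ! j \<in> pos_ideal"
    using assms nth_pos_ideal by auto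
  then have "xs ! j \<otimes> scale g (xs ! i) = xs ! i \<otimes> scale g (xs ! j)"
    by (intro h_eqI) (auto simp: scale pos_ideal_def)
  then show ?thesis
    using assms ij by (intro W.frac_eqI nth_mem_loc scale) auto
qed

text \<open>Shows that the image of a 0-cochain is again of the form \<open>cochain\<close>, as
  needed for the coboundaries.\<close>

lemma fraction_one_eq:
  assumes "J \<subseteq> {..<length xs}" "j \<in> J" "a \<in> carrier B"
  shows "fraction B (cech_loc B xs J) a \<one> =
    fraction B (cech_loc B xs J) (scale (h a) (xs ! j)) (xs ! j)"
proof -
  interpret W: mult_subset B "cech_loc B xs J"
    by (rule mult_subset_loc) fact
  have j: "xs ! j \<in> pos_ideal" "xs ! j \<in> carrier B"
    using assms nth_pos_ideal nth_closed by auto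
  then have "xs ! j \<otimes> a = \<one> \<otimes> scale (h a) (xs ! j)"
    using assms(3) by (intro h_eqI) (auto simp: scale)
  then show ?thesis
    using assms j by (intro W.frac_eqI nth_mem_loc scale W.one_mem)
qed

lemma fraction_scale_add:
  assumes "J \<subseteq> {..<length xs}" "j \<in> J"
  shows "fraction B (cech_loc B xs J) (scale f (xs ! j)) (xs ! j)
    \<oplus>\<^bsub>localization B (cech_loc B xs J)\<^esub> fraction B (cech_loc B xs J) (scale g (xs ! j)) (xs ! j) =
    fraction B (cech_loc B xs J) (scale (f + g) (xs ! j)) (xs ! j)"
proof -
  interpret W: mult_subset B "cech_loc B xs J"
    by (rule mult_subset_loc) fact
  let ?x = "xs ! j"
  have j: "?x \<in> pos_ideal" "?x \<in> carrier B" "?x \<in> cech_loc B xs J"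
    using assms nth_pos_ideal nth_closed nth_mem_loc by auto
  then have "?x \<otimes> (?x \<otimes> scale f ?x \<oplus> ?x \<otimes> scale g ?x) = (?x \<otimes> ?x) \<otimes> scale (f + g) ?x"
    by (intro h_eqI) (auto simp: scale algebra_simps)
  then have "W.frc (?x \<otimes> scale f ?x \<oplus> ?x \<otimes> scale g ?x) (?x \<otimes> ?x) = W.frc (scale (f + g) ?x) ?x"
    using j by (intro W.frac_eqI) (simp_all add: scale W.mult_mem)
  then show ?thesis
    using j by (simp add: W.add_frac scale)
qed

lemma frobenius_fraction_scale:
  assumes "J \<subseteq> {..<length xs}" "j \<in> J"
  shows "frobenius 2 (localization B (cech_loc B xs J))
      (fraction B (cech_loc B xs J) (scale g (xs ! j)) (xs ! j)) =
    fraction B (cech_loc B xs J) (scale (g ^ 2) (xs ! j)) (xs ! j)"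
proof -
  interpret W: mult_subset B "cech_loc B xs J"
    by (rule mult_subset_loc) fact
  let ?x = "xs ! j"
  have j: "?x \<in> pos_ideal" "?x \<in> carrier B" "?x \<in> cech_loc B xs J"
    using assms nth_pos_ideal nth_closed nth_mem_loc by auto
  then have "?x \<otimes> scale g ?x [^] (2::nat) = ?x [^] (2::nat) \<otimes> scale (g ^ 2) ?x"
    by (intro h_eqI) (auto simp: scale power_mult_distrib)
  then have "W.frc (scale g ?x [^] (2::nat)) (?x [^] (2::nat)) = W.frc (scale (g ^ 2) ?x) ?x"
    using j by (intro W.frac_eqI) (simp_all add: scale W.pow_mem)
  then show ?thesis
    using j by (simp add: W.frobenius_frac scale)
qed

text \<open>The denominators at one position are powers of x_j, which is nonzero and can be
  cancelled in k[[s]].\<close>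

lemma fraction_scale_inj:
  assumes "j < length xs" "xs ! j \<noteq> \<zero>"
    and eq: "fraction B (cech_loc B xs {j}) (scale f (xs ! j)) (xs ! j) =
      fraction B (cech_loc B xs {j}) (scale g (xs ! j)) (xs ! j)"
  shows "f = g"
proof -
  interpret W: mult_subset B "cech_loc B xs {j}"
    using assms(1) by (intro mult_subset_loc) auto
  let ?x = "xs ! j"
  have j: "?x \<in> pos_ideal" "?x \<in> carrier B" "?x \<in> cech_loc B xs {j}"
    using assms nth_pos_ideal nth_closed nth_mem_loc [of "{j}"] by auto
  have nz: "h ?x \<noteq> 0"
    using assms(2) j(2) by (simp add: h_eq_0_iff)
  obtain u where u: "u \<in> cech_loc B xs {j}" "u \<otimes> (?x \<otimes> scale f ?x) = u \<otimes> (?x \<otimes> scale g ?x)"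
    using eq j by (subst (asm) W.frac_eq_iff) (auto simp: scale)
  then obtain n where "u = ?x [^] (n::nat)"
    using cech_loc_singleton [OF j(2)] by auto
  then have "h ?x ^ n * (h ?x * (f * h ?x)) = h ?x ^ n * (h ?x * (g * h ?x))"
    using arg_cong [OF u(2), of h] j by (simp add: scale)
  then show ?thesis
    using nz by simp
qed

lemma cech_index_1: "cech_index xs 1 = {{j} | j. j < length xs}"
  unfolding cech_index_def by (auto simp: card_1_singleton_iff)

lemma singleton_mem_cech_index [simp]: "{j} \<in> cech_index xs (Suc 0) \<longleftrightarrow> j < length xs"
  unfolding cech_index_def by simp

lemma cech_index_0: "cech_index xs 0 = {{}}"
  unfolding cech_index_def using finite_subset [of _ "{..<length xs}"] by auto

lemma cochain_closed: "cochain xs g \<in> carrier (cech_cochains B xs 1)"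
proof -
  have "fraction B (cech_loc B xs {j}) (scale g (xs ! j)) (xs ! j)
    \<in> carrier (localization B (cech_loc B xs {j}))" if "j < length xs" for j
  proof -
    interpret W: mult_subset B "cech_loc B xs {j}"
      using that by (intro mult_subset_loc) auto
    show ?thesis
      using that nth_mem_loc [of "{j}"] by (intro W.frac_closed scale nth_pos_ideal) auto
  qed
  then show ?thesis
    unfolding cech_cochains_def cochain_def cech_index_1 by (auto simp: restrict_PiE_iff)
qed

lemma cochain_add: "cochain xs f \<otimes>\<^bsub>cech_cochains B xs 1\<^esub> cochain xs g = cochain xs (f + g)"
proof -
  have "cochain xs f J \<oplus>\<^bsub>localization B (cech_loc B xs J)\<^esub> cochain xs g J = cochain xs (f + g) J"
    if J: "J \<in> cech_index xs 1" for J
  proof -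
    obtain j where "J = {j}" "j < length xs"
      using J unfolding cech_index_1 by blast
    then show ?thesis
      using J fraction_scale_add [of J j f g] by (simp add: cochain_def)
  qed
  moreover have "cochain xs (f + g) \<in> extensional (cech_index xs 1)"
    by (simp add: cochain_def)
  ultimately show ?thesis
    unfolding cech_cochains_def by (auto simp: fun_eq_iff extensional_def)
qed

lemma cochain_frobenius:
  "(\<lambda>J\<in>cech_index xs 1. frobenius 2 (localization B (cech_loc B xs J)) (cochain xs g J)) =
    cochain xs (g ^ 2)"
proof (rule ext)
  fix J
  show "(\<lambda>J\<in>cech_index xs 1. frobenius 2 (localization B (cech_loc B xs J)) (cochain xs g J)) J =
    cochain xs (g ^ 2) J"
  proof (cases "J \<in> cech_index xs 1")
    case True
    then obtain j where "J = {j}" "j < length xs"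
      unfolding cech_index_1 by blast
    then show ?thesis
      using True frobenius_fraction_scale [of J j g] by (simp add: cochain_def)
  qed (simp add: cochain_def)
qed

text \<open>Generators of a nonzero ideal are not all zero, and the component at one nonzero
  generator already determines the series.\<close>

lemma cochain_inj:
  assumes "cochain xs f = cochain xs g" "Idl (set xs) = pos_ideal"
  shows "f = g"
proof -
  have "\<not> set xs \<subseteq> {\<zero>}"
    using genideal_minimal [OF zeroideal, of "set xs"] assms(2) pos_ideal_nonzero
      lift_pos_ideal [of 1] lift_eq_0_iff [of 1] by (metis singletonD subsetD zero_neq_one)
  then obtain j where j: "j < length xs" "xs ! j \<noteq> \<zero>"
    by (metis in_set_conv_nth singletonI subsetI)
  then show ?thesis
    using fun_cong [OF assms(1), of "{j}"] j by (intro fraction_scale_inj [OF j]) (simp add: cochain_def)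
qed

text \<open>In degree 0 the complex is \<open>B\<close> localized at 1, and the differential sends
  \<open>a\<close> to a/1 at each position. So the coboundaries come from exactly those series that
  lie in the image of \<open>h\<close>.\<close>

lemma coboundaries: "cech_coboundaries B xs 1 = {cochain xs f | f. f $ 1 = 0}"
proof -
  have diff: "cech_diff B xs 0 c = cochain xs (h a)"
    if c: "c {} = fraction B {\<one>} a \<one>" and a: "a \<in> carrier B" for c a
  proof (rule ext)
    fix J
    show "cech_diff B xs 0 c J = cochain xs (h a) J"
    proof (cases "J \<in> cech_index xs 1")
      case True
      then obtain j where J: "J = {j}" "j < length xs"
        unfolding cech_index_1 by blast
      interpret W: mult_subset B "cech_loc B xs J"
        using J by (intro mult_subset_loc) auto
      interpret L: abelian_group "localization B (cech_loc B xs J)"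
        by (rule W.abelian_group_L)
      have map: "loc_map B (cech_loc B xs J) (c {}) = fraction B (cech_loc B xs J) a \<one>"
        unfolding c cech_loc_empty [of xs, symmetric]
        using J a W.one_mem by (intro loc_map_fraction mult_subset_loc cech_loc_mono) (auto intro: nth_closed simp: cech_loc_empty)
      let ?t = "\<lambda>l. add_pow (localization B (cech_loc B xs J)) ((-1 :: int) ^ card {k \<in> J. k < l})
        (loc_map B (cech_loc B xs J) (c (J - {l})))"
      \<comment> \<open>A singleton index leaves one summand, with sign exponent 0.\<close>
      have sets: "{k \<in> J. k < j} = {}" "J - {j} = {}"
        using J by auto
      have t: "?t j = fraction B (cech_loc B xs J) a \<one>"
        unfolding sets map using L.add.int_pow_1 [OF W.frac_closed [OF a W.one_mem]] by simp
      have "cech_diff B xs 0 c J = finsum (localization B (cech_loc B xs J)) ?t {j}"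
        using True by (simp add: cech_diff_def J(1) Let_def)
      also have "\<dots> = ?t j"
        using a W.one_mem t by (subst L.finsum_insert) auto
      also have "\<dots> = fraction B (cech_loc B xs J) a \<one>"
        by (rule t)
      also have "\<dots> = cochain xs (h a) J"
        using J a fraction_one_eq [of J j a] by (simp add: cochain_def)
      finally show ?thesis .
    qed (simp add: cech_diff_def cochain_def)
  qed
  interpret W0: mult_subset B "{\<one>}"
    using mult_subset_loc [of "{}"] by (simp add: cech_loc_empty)
  have carrier: "c \<in> carrier (cech_cochains B xs 0) \<longleftrightarrow>
      c \<in> extensional {{}} \<and> c {} \<in> carrier (localization B {\<one>})" for c
    unfolding cech_cochains_def cech_index_0 by (simp add: cech_loc_empty PiE_iff conj_commute)
  have "cech_diff B xs 0 ` carrier (cech_cochains B xs 0) = (\<lambda>a. cochain xs (h a)) ` carrier B"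
  proof (intro equalityI subsetI)
    fix y
    assume "y \<in> cech_diff B xs 0 ` carrier (cech_cochains B xs 0)"
    then obtain c where c: "y = cech_diff B xs 0 c" "c \<in> carrier (cech_cochains B xs 0)"
      by (rule imageE)
    then have "c {} \<in> carrier (localization B {\<one>})"
      by (simp add: carrier)
    then obtain a s where "c {} = fraction B {\<one>} a s" "a \<in> carrier B" "s \<in> {\<one>}"
      by (rule W0.carrier_LE)
    then show "y \<in> (\<lambda>a. cochain xs (h a)) ` carrier B"
      using diff [of c a] c(1) by simp
  next
    fix y
    assume "y \<in> (\<lambda>a. cochain xs (h a)) ` carrier B"
    then obtain a where a: "y = cochain xs (h a)" "a \<in> carrier B"
      by (rule imageE)
    define c where "c = (\<lambda>J\<in>{{} :: nat set}. fraction B {\<one>} a \<one>)"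
    have "c \<in> carrier (cech_cochains B xs 0)"
      unfolding carrier using a by (simp add: c_def)
    moreover have "cech_diff B xs 0 c = y"
      using diff [of c a] a by (simp add: c_def)
    ultimately show "y \<in> cech_diff B xs 0 ` carrier (cech_cochains B xs 0)"
      using imageI [of c "carrier (cech_cochains B xs 0)" "cech_diff B xs 0"] by simp
  qed
  then have "cech_coboundaries B xs 1 = (\<lambda>a. cochain xs (h a)) ` carrier B"
    by (simp add: cech_coboundaries_def)
  also have "\<dots> = cochain xs ` (h ` carrier B)"
    by (simp add: image_image)
  finally show ?thesis
    unfolding image_h by auto
qed

text \<open>On a pair of positions both components become the same fraction and enter with opposite
  signs.\<close>

lemma cochain_cocycle: "cochain xs g \<in> cech_cocycles B xs 1"
proof -
  have zero: "cech_diff B xs 1 (cochain xs g) J = \<zero>\<^bsub>localization B (cech_loc B xs J)\<^esub>"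
    if J: "J \<in> cech_index xs 2" for J
  proof -
    have "J \<subseteq> {..<length xs}" "card J = 2"
      using J by (auto simp: cech_index_def)
    moreover obtain a b where ab: "J = {a, b}" "a \<noteq> b"
      using \<open>card J = 2\<close> by (metis card_2_iff)
    \<comment> \<open>The two elements are ordered because the sign counts the smaller members of
      \<open>J\<close>.\<close>
    moreover have "J = {min a b, max a b}" "min a b < max a b"
      using ab by (auto simp: min_def max_def)
    ultimately obtain i j where ij: "J = {i, j}" "i < j" "i < length xs" "j < length xs"
      by (metis insert_subset lessThan_iff)
    let ?L = "localization B (cech_loc B xs J)"
    interpret W: mult_subset B "cech_loc B xs J"
      using ij by (intro mult_subset_loc) auto
    interpret L: abelian_group ?L
      by (rule W.abelian_group_L)
    define v where "v = fraction B (cech_loc B xs J) (scale g (xs ! j)) (xs ! j)"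
    have v: "v \<in> carrier ?L"
      unfolding v_def using ij by (intro W.frac_closed scale nth_pos_ideal nth_mem_loc) auto
    have map: "loc_map B (cech_loc B xs J) (cochain xs g {l}) = v" if "l \<in> J" for l
    proof -
      have l: "l < length xs"
        using that ij by auto
      then have "cochain xs g {l} = fraction B (cech_loc B xs {l}) (scale g (xs ! l)) (xs ! l)"
        by (simp add: cochain_def cech_index_1)
      also have "loc_map B (cech_loc B xs J) \<dots> =
          fraction B (cech_loc B xs J) (scale g (xs ! l)) (xs ! l)"
        using that ij l
        by (intro loc_map_fraction mult_subset_loc cech_loc_mono scale nth_pos_ideal nth_mem_loc)
          (auto intro: nth_closed)
      also have "\<dots> = v"
        unfolding v_def using that ij by (intro fraction_scale_eq) auto
      finally show ?thesis .
    qed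
    have sets: "J - {i} = {j}" "J - {j} = {i}" "{l \<in> J. l < i} = {}" "{l \<in> J. l < j} = {i}"
      using ij by auto
    let ?t = "\<lambda>l. add_pow ?L ((-1 :: int) ^ card {k \<in> J. k < l}) (loc_map B (cech_loc B xs J) (cochain xs g (J - {l})))"
    have t: "?t i = v" "?t j = \<ominus>\<^bsub>?L\<^esub> v"
      unfolding sets using v L.add.int_pow_1 [OF v] L.add.int_pow_neg [OF v, of 1] map [of i] map [of j] ij(1)
      by simp_all
    have "cech_diff B xs 1 (cochain xs g) J = finsum ?L ?t {i, j}"
      using J by (simp add: cech_diff_def ij(1) numeral_2_eq_2 Let_def)
    also have "\<dots> = ?t i \<oplus>\<^bsub>?L\<^esub> ?t j"
      using ij(2) v t by (subst L.finsum_insert) auto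
    also have "\<dots> = \<zero>\<^bsub>?L\<^esub>"
      unfolding t using v by (rule L.r_neg)
    finally show ?thesis .
  qed
  have "cech_diff B xs 1 (cochain xs g) = \<one>\<^bsub>cech_cochains B xs 2\<^esub>"
  proof (rule ext)
    fix J
    show "cech_diff B xs 1 (cochain xs g) J = \<one>\<^bsub>cech_cochains B xs 2\<^esub> J"
    proof (cases "J \<in> cech_index xs 2")
      case True
      then show ?thesis
        using zero by (simp add: cech_cochains_def)
    next
      case False
      then show ?thesis
        by (simp add: cech_cochains_def cech_diff_def numeral_2_eq_2)
    qed
  qed
  then show ?thesis
    unfolding cech_cocycles_def kernel_def using cochain_closed by (simp add: numeral_2_eq_2)
qed

text \<open>A right coset involves only the multiplication, so it is unaffected when
  \<open>cech_cohomology\<close> restricts the carrier to cocycles; hence the arbitrary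
  \<open>Z\<close>.\<close>

lemma coset_cochain:
  "r_coset ((cech_cochains B xs 1)\<lparr>carrier := Z\<rparr>) (cech_coboundaries B xs 1) (cochain xs g) =
    {cochain xs (f + g) | f. f $ 1 = 0}"
  unfolding r_coset_def coboundaries by (auto simp flip: cochain_add)

text \<open>Frobenius replaces \<open>g\<close> by its square, which has no linear term, so every
  class of this form goes to zero.\<close>

lemma cech_frobenius_coset:
  "cech_frobenius 2 B xs 1 {cochain xs (f + g) | f. f $ 1 = 0} = {cochain xs f | f. f $ 1 = 0}"
proof -
  have "r_coset (cech_cochains B xs 1) (cech_coboundaries B xs 1) (cochain xs (f ^ 2)) =
    {cochain xs f | f. f $ 1 = 0}" for f
  proof -
    have "r_coset (cech_cochains B xs 1) (cech_coboundaries B xs 1) (cochain xs (f ^ 2)) =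
      {cochain xs (e + f ^ 2) | e. e $ 1 = 0}"
      unfolding r_coset_def coboundaries by (auto simp flip: cochain_add)
    also have "\<dots> = {cochain xs e | e. e $ 1 = 0}"
    \<comment> \<open>Translation by f^2 permutes the series without linear term.\<close>
    proof (intro equalityI subsetI)
      fix c
      assume "c \<in> {cochain xs e | e. e $ 1 = 0}"
      then obtain e where "c = cochain xs ((e - f ^ 2) + f ^ 2)" "(e - f ^ 2) $ 1 = 0"
        using square_nth_1 [of f] by auto
      then show "c \<in> {cochain xs (e + f ^ 2) | e. e $ 1 = 0}"
        by blast
    next
      fix c
      assume "c \<in> {cochain xs (e + f ^ 2) | e. e $ 1 = 0}"
      then obtain e where "c = cochain xs (e + f ^ 2)" "(e + f ^ 2) $ 1 = 0"
        using square_nth_1 [of f] by auto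
      then show "c \<in> {cochain xs e | e. e $ 1 = 0}"
        by blast
    qed
    finally show ?thesis .
  qed
  moreover have "{cochain xs (f + g) | f. f $ 1 = 0} \<noteq> {}"
    using fps_zero_nth by blast
  ultimately show ?thesis
    unfolding cech_frobenius_def
    by (intro SUP_eq_const) (auto simp only: cochain_frobenius mem_Collect_eq)
qed

text \<open>The classes of s and of 0 have the same image. If they were equal,
  \<open>cochain_inj\<close> would equate s with a series without linear term.\<close>

lemma cech_frobenius_not_inj:
  assumes "Idl (set xs) = pos_ideal"
  shows "\<not> inj_on (cech_frobenius 2 B xs 1) (carrier (cech_cohomology B xs 1))"
proof
  let ?C = "\<lambda>g. {cochain xs (f + g) | f. f $ 1 = 0}"
  assume inj: "inj_on (cech_frobenius 2 B xs 1) (carrier (cech_cohomology B xs 1))"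
  have closed: "?C g \<in> carrier (cech_cohomology B xs 1)" for g
    unfolding cech_cohomology_def FactGroup_def RCOSETS_def
    using coset_cochain cochain_cocycle by fastforce
  have "?C fps_X = ?C 0"
    by (rule inj_onD [OF inj]) (simp_all only: cech_frobenius_coset closed)
  moreover have "cochain xs (0 + fps_X) \<in> ?C fps_X"
    by (intro CollectI exI [of _ 0]) simp
  ultimately obtain f where "cochain xs (0 + fps_X) = cochain xs (f + 0)" "f $ 1 = 0"
    by blast
  then show False
    using cochain_inj [OF _ assms, of "0 + fps_X" "f + 0"] by auto
qed

end

text \<open>A concrete list is needed to know that the choice in \<open>max_ideal_gens\<close>
  succeeds. Splitting v into even and odd parts writes s^2 v as s^2 u + s^3 w with u and w even,
  hence in the image of \<open>h\<close>.\<close>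

lemma pos_ideal_generators: "Idl (set [lift 1, lift fps_X]) = pos_ideal"
proof (intro equalityI subsetI)
  fix a
  have "set [lift 1, lift fps_X] \<subseteq> pos_ideal"
    by simp
  moreover assume "a \<in> Idl (set [lift 1, lift fps_X])"
  ultimately show "a \<in> pos_ideal"
    using genideal_minimal [of pos_ideal "set [lift 1, lift fps_X]"] primeideal_pos_ideal
    by (auto simp: primeideal_def)
next
  fix a
  assume "a \<in> pos_ideal"
  then have a: "a \<in> carrier B" "h a $ 0 = 0" "h a $ 1 = 0"
    using image_h by (auto simp: pos_ideal_def)
  define v where "v = fps_shift 2 (h a)"
  have hav: "h a = fps_X ^ 2 * v"
  proof (rule fps_ext)
    fix n
    show "h a $ n = (fps_X ^ 2 * v) $ n"
      using a(2,3) by (cases "n < 2") (auto simp: v_def fps_X_power_mult_nth less_2_cases_iff simp flip: Suc_diff_le)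
  qed
  define u w where "u = Abs_fps (\<lambda>n. v $ (2 * n)) oo fps_X ^ 2"
    and "w = Abs_fps (\<lambda>n. v $ (2 * n + 1)) oo fps_X ^ 2"
  have v: "v = u + fps_X * w"
    unfolding u_def w_def by (rule fps_even_odd)
  have "u \<in> h ` carrier B" "w \<in> h ` carrier B"
    unfolding image_h u_def w_def by (simp_all add: fps_nth_compose_X_power)
  then obtain b c where bc: "b \<in> carrier B" "h b = u" "c \<in> carrier B" "h c = w"
    by blast
  have "h a = h (lift 1 \<otimes> b \<oplus> lift fps_X \<otimes> c)"
    using bc by (simp add: hav v algebra_simps)
  then have "a = lift 1 \<otimes> b \<oplus> lift fps_X \<otimes> c"
    using a(1) bc by (intro h_eqI) auto
  also have "\<dots> \<in> Idl (set [lift 1, lift fps_X])"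
  proof -
    let ?I = "Idl (set [lift 1, lift fps_X])"
    interpret I: ideal ?I B
      by (rule genideal_ideal) simp
    have "set [lift 1, lift fps_X] \<subseteq> ?I"
      by (rule genideal_self) simp
    then show ?thesis
      using bc by (intro I.a_closed I.I_r_closed) auto
  qed
  finally show "a \<in> Idl (set [lift 1, lift fps_X])" .
qed

lemma not_F_injective: "\<not> F_injective 2 B"
proof -
  define xs where "xs = max_ideal_gens B"
  have "\<exists>xs. set xs \<subseteq> carrier B \<and> Idl (set xs) = max_ideal B"
    unfolding max_ideal_eq by (intro exI [of _ "[lift 1, lift fps_X]"] conjI pos_ideal_generators) simp
  then have xs: "set xs \<subseteq> carrier B" "Idl (set xs) = pos_ideal"
    unfolding xs_def max_ideal_gens_def max_ideal_eq [symmetric] by (rule someI2_ex; simp)+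
  have "\<not> inj_on (cech_frobenius 2 B xs 1) (carrier (cech_cohomology B xs 1))"
    using genideal_self [OF xs(1)] xs(2) by (intro cech_frobenius_not_inj) auto
  then show ?thesis
    unfolding F_injective_def local_cohomology_frobenius_def local_cohomology_def xs_def by blast
qed

end

subsection \<open>The extension by a square root of \<open>x\<close>\<close>

lemma ring_type_algebra: "ring (ring_of_type_algebra :: 'a::comm_ring_1 ring)"
  by (rule ring_from_type_algebra)

lemma cring_type_algebra: "cring (ring_of_type_algebra :: 'a::comm_ring_1 ring)"
  by (rule cring_from_type_algebra)

lemma domain_type_algebra: "domain (ring_of_type_algebra :: 'a::idom ring)"
  by (rule domainI [OF cring_type_algebra]) auto

lemma PIdl_type_algebra:
  fixes a :: "'a::comm_ring_1"
  shows "PIdl\<^bsub>ring_of_type_algebra\<^esub> a = {f. a dvd f}"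
  unfolding cgenideal_def by (auto simp: dvd_def mult.commute)

lemma power_type_algebra [simp]:
  fixes a :: "'a::comm_ring_1"
  shows "a [^]\<^bsub>ring_of_type_algebra\<^esub> (n::nat) = a ^ n"
  by (induction n) (simp_all add: mult.commute)

text \<open>The homomorphism \<open>k[[x,y]][T] \<rightarrow> k[[t,y]]\<close> with \<open>x \<mapsto> t\<^sup>2\<close>, \<open>y \<mapsto> y\<close>, \<open>T \<mapsto> t\<close>.\<close>

definition root_eval :: "'a::field fps fps poly \<Rightarrow> 'a fps fps" where
  "root_eval q = poly (map_poly (\<lambda>f. f oo fps_X ^ 2) q) fps_X"

lemma root_eval_0 [simp]: "root_eval 0 = 0"
  by (simp add: root_eval_def)

lemma root_eval_pCons [simp]: "root_eval (pCons f q) = (f oo fps_X ^ 2) + fps_X * root_eval q"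
  by (simp add: root_eval_def map_poly_pCons)

lemma root_eval_1 [simp]: "root_eval 1 = 1"
  by (simp add: one_pCons)

lemma root_eval_add: "root_eval (p + q) = root_eval p + root_eval q"
  by (induction p q rule: poly_induct2) (simp_all add: fps_compose_add_distrib algebra_simps)

lemma root_eval_smult: "root_eval (Polynomial.smult f q) = (f oo fps_X ^ 2) * root_eval q"
  by (induction q) (simp_all add: fps_compose_mult_distrib algebra_simps)

lemma root_eval_mult: "root_eval (p * q) = root_eval p * root_eval q"
  by (induction p) (simp_all add: root_eval_add root_eval_smult algebra_simps)

lemma root_eval_relation [simp]: "root_eval (Polynomial.monom 1 2 - [:ps_x:]) = 0"
proof -
  have "(Polynomial.monom 1 2 - [:ps_x:] :: 'a fps fps poly) = [:- ps_x, 0, 1:]"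
    by (simp add: monom_altdef power2_eq_square)
  then show ?thesis
    by (simp add: ps_x_def fps_compose_uminus power2_eq_square)
qed

lemma poly_mod_relation:
  "\<exists>d a b. q = d * (Polynomial.monom 1 2 - [:ps_x:]) + [:a, b:]"
proof (induction q)
  case 0
  show ?case
    by (rule exI [of _ 0], rule exI [of _ 0], rule exI [of _ 0]) simp
next
  case (pCons c q)
  then obtain d a b where q: "q = d * (Polynomial.monom 1 2 - [:ps_x:]) + [:a, b:]"
    by blast
  have m: "(Polynomial.monom 1 2 - [:ps_x:] :: 'a fps fps poly) = [:- ps_x, 0, 1:]"
    by (simp add: monom_altdef power2_eq_square)
  \<comment> \<open>Multiplying the remainder by T produces b T^2, which is b (T^2 - x) + b
    x.\<close>
  have "pCons c q = (pCons 0 d + [:b:]) * (Polynomial.monom 1 2 - [:ps_x:]) + [:c + b * ps_x, a:]"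
    unfolding q m by (simp add: algebra_simps)
  then show ?case
    by blast
qed

text \<open>The remainder a + b T becomes a(t^2) + t b(t^2), whose two parts are separated by
  parity.\<close>

lemma root_eval_eq_0_iff: "root_eval q = 0 \<longleftrightarrow> Polynomial.monom 1 2 - [:ps_x:] dvd q"
proof
  assume q: "root_eval q = 0"
  obtain d a b where d: "q = d * (Polynomial.monom 1 2 - [:ps_x:]) + [:a, b:]"
    using poly_mod_relation by blast
  have "(a oo fps_X ^ 2) + fps_X ^ 1 * (b oo fps_X ^ 2) = 0"
    using q by (simp add: d root_eval_add root_eval_mult)
  then have "a = 0" "b = 0"
    using fps_even_odd_eq_0 [of a 1 b] by auto
  then show "Polynomial.monom 1 2 - [:ps_x:] dvd q"
    using d by simp
qed (auto simp: root_eval_mult)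

lemma surj_root_eval: "range root_eval = UNIV"
proof -
  have "\<exists>q. g = root_eval q" for g :: "'a fps fps"
    using fps_even_odd [of g]
    by (intro exI [of _ "[:Abs_fps (\<lambda>n. g $ (2 * n)), Abs_fps (\<lambda>n. g $ (2 * n + 1)):]"]) simp
  then show ?thesis
    by blast
qed

context
begin

interpretation root: ring_hom_ring "poly_over_ps :: 'a::field fps fps poly ring" ps_ring root_eval
  by (rule ring_hom_ringI)
    (auto simp: poly_over_ps_def ps_ring_def ring_type_algebra root_eval_add root_eval_mult)

lemma a_kernel_root_eval:
  "a_kernel poly_over_ps ps_ring root_eval = (ext_ideal 2 :: 'a::field fps fps poly set)"
  unfolding ext_ideal_def a_kernel_def' poly_over_ps_def ps_ring_def PIdl_type_algebra
  by (simp add: root_eval_eq_0_iff)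

lemma ext_ideal_2: "ideal (ext_ideal 2 :: 'a::field fps fps poly set) poly_over_ps"
  using root.kernel_is_ideal by (simp only: a_kernel_root_eval)

lemma ext_ring_iso:
  "\<exists>\<phi>\<in>ring_iso (ext_ring 2) (ps_ring :: 'a::field fps fps ring).
    \<phi> (ext_t 2) = fps_X \<and> (\<forall>f. \<phi> (ext_hom 2 f) = f oo fps_X ^ 2)"
proof (intro bexI conjI allI)
  define \<phi> where "\<phi> = (\<lambda>C :: 'a fps fps poly set. the_elem (root_eval ` C))"
  show "\<phi> \<in> ring_iso (ext_ring 2) ps_ring"
    using root.FactRing_iso_set unfolding \<phi>_def ext_ring_def a_kernel_root_eval [symmetric]
    by (simp add: surj_root_eval ps_ring_def poly_over_ps_def)
  have \<phi>: "\<phi> (ext_ideal 2 +>\<^bsub>poly_over_ps\<^esub> q) = root_eval q" for q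
    unfolding \<phi>_def a_kernel_root_eval [symmetric]
    by (rule root.the_elem_simp) (simp add: poly_over_ps_def)
  show "\<phi> (ext_t 2) = fps_X"
    by (simp add: ext_t_def \<phi> monom_altdef)
  show "\<phi> (ext_hom 2 f) = f oo fps_X ^ 2" for f
    by (simp add: ext_hom_def \<phi>)
qed

end

lemma cring_ext_ring: "cring (ext_ring 2 :: 'a::field fps fps poly set ring)"
  unfolding ext_ring_def
  by (rule ideal.quotient_is_cring [OF ext_ideal_2]) (simp add: poly_over_ps_def cring_type_algebra)

lemma ext_hom_ring_hom: "ext_hom 2 \<in> ring_hom (ps_ring :: 'a::field fps fps ring) (ext_ring 2)"
proof -
  interpret I: ideal "ext_ideal 2 :: 'a fps fps poly set" poly_over_ps
    by (rule ext_ideal_2)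
  have "(\<lambda>f. [:f:]) \<in> ring_hom (ps_ring :: 'a fps fps ring) poly_over_ps"
    by (rule ring_hom_memI) (auto simp: ps_ring_def poly_over_ps_def one_pCons)
  then have "(+>\<^bsub>poly_over_ps\<^esub>) (ext_ideal 2) \<circ> (\<lambda>f. [:f:]) \<in> ring_hom (ps_ring :: 'a fps fps ring) (ext_ring 2)"
    unfolding ext_ring_def by (rule ring_hom_trans [OF _ I.rcos_ring_hom])
  moreover have "(+>\<^bsub>poly_over_ps\<^esub>) (ext_ideal 2) \<circ> (\<lambda>f. [:f:]) = (ext_hom 2 :: 'a fps fps \<Rightarrow> _)"
    by (simp add: fun_eq_iff ext_hom_def)
  ultimately show ?thesis
    by simp
qed

text \<open>The basis is 1, t. In k[[t,y]] the coordinates of an element are its even and odd parts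
  with respect to t.\<close>

lemma free_ext_ring:
  "free_of_rank ps_ring (module_along (ext_hom 2) (ext_ring 2 :: 'a::field fps fps poly set ring)) 2"
proof -
  let ?S = "ext_ring 2 :: 'a fps fps poly set ring"
  let ?M = "module_along (ext_hom 2) ?S"
  obtain \<phi> where \<phi>: "\<phi> \<in> ring_iso ?S ps_ring"
    "\<phi> (ext_t 2) = fps_X" "\<And>f. \<phi> (ext_hom 2 f) = f oo fps_X ^ 2"
    using ext_ring_iso by blast
  interpret S: cring ?S
    by (rule cring_ext_ring)
  interpret \<phi>: ring_hom_ring ?S "ps_ring :: 'a fps fps ring" \<phi>
    using \<phi>(1) by (intro ring_hom_ringI2) (auto simp: ring_iso_def ps_ring_def ring_type_algebra S.ring_axioms)
  have inj: "inj_on \<phi> (carrier ?S)"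
    using \<phi>(1) by (simp add: ring_iso_def bij_betw_def)
  interpret M: module ps_ring ?M
    by (rule module_module_along)
      (simp_all add: ps_ring_def cring_type_algebra S.ring_axioms ext_hom_ring_hom [unfolded ps_ring_def])
  define b where "b i = (if i = (0::nat) then \<one>\<^bsub>?S\<^esub> else ext_t 2)" for i
  have hom_closed: "ext_hom 2 f \<in> carrier ?S" for f :: "'a fps fps"
    using ring_hom_closed [OF ext_hom_ring_hom, of f] by (simp add: ps_ring_def)
  have "ext_t 2 \<in> carrier ?S"
    unfolding ext_t_def ext_ring_def FactRing_def A_RCOSETS_def' by (auto simp: poly_over_ps_def)
  then have b: "b i \<in> carrier ?S" for i
    by (simp add: b_def)
  have \<phi>_sum: "(\<Oplus>\<^bsub>?M\<^esub>i\<in>{..<2}. r i \<odot>\<^bsub>?M\<^esub> b i) \<in> carrier ?S \<and>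
      \<phi> (\<Oplus>\<^bsub>?M\<^esub>i\<in>{..<2}. r i \<odot>\<^bsub>?M\<^esub> b i) = (r 0 oo fps_X ^ 2) + fps_X * (r 1 oo fps_X ^ 2)" for r
  proof -
    have closed: "ext_hom 2 (r i) \<otimes>\<^bsub>?S\<^esub> b i \<in> carrier ?S" for i
      by (intro S.m_closed hom_closed b)
    have "(\<Oplus>\<^bsub>?M\<^esub>i\<in>{..<2}. r i \<odot>\<^bsub>?M\<^esub> b i) = (\<Oplus>\<^bsub>?M\<^esub>i\<in>{0, 1}. r i \<odot>\<^bsub>?M\<^esub> b i)"
      by (simp add: numeral_2_eq_2 lessThan_Suc insert_commute)
    also have "\<dots> = r 0 \<odot>\<^bsub>?M\<^esub> b 0 \<oplus>\<^bsub>?M\<^esub> r 1 \<odot>\<^bsub>?M\<^esub> b 1"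
      using closed by (simp add: M.finsum_insert Pi_def)
    finally have eq: "(\<Oplus>\<^bsub>?M\<^esub>i\<in>{..<2}. r i \<odot>\<^bsub>?M\<^esub> b i) =
        ext_hom 2 (r 0) \<otimes>\<^bsub>?S\<^esub> b 0 \<oplus>\<^bsub>?S\<^esub> ext_hom 2 (r 1) \<otimes>\<^bsub>?S\<^esub> b 1"
      by simp
    have "\<phi> (b 0) = 1" "\<phi> (b 1) = fps_X"
      using \<phi>.hom_one \<phi>(2) by (simp_all add: b_def ps_ring_def)
    then show ?thesis
      unfolding eq using closed hom_closed b
      by (simp add: \<phi>(3)) (simp add: ps_ring_def mult.commute)
  qed
  have unique: "\<exists>!r. r \<in> {..<2} \<rightarrow>\<^sub>E carrier ps_ring \<and> m = (\<Oplus>\<^bsub>?M\<^esub>i\<in>{..<2}. r i \<odot>\<^bsub>?M\<^esub> b i)"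
    if "m \<in> carrier ?M" for m
  proof (rule ex_ex1I)
    have m: "m \<in> carrier ?S"
      using that by simp
    let ?r = "\<lambda>i\<in>{..<2::nat}. Abs_fps (\<lambda>n. \<phi> m $ (2 * n + i))"
    have eq: "\<phi> (\<Oplus>\<^bsub>?M\<^esub>i\<in>{..<2}. ?r i \<odot>\<^bsub>?M\<^esub> b i) = \<phi> m"
      using \<phi>_sum [of ?r] fps_even_odd [of "\<phi> m"] by simp
    have "m = (\<Oplus>\<^bsub>?M\<^esub>i\<in>{..<2}. ?r i \<odot>\<^bsub>?M\<^esub> b i)"
      by (rule inj_onD [OF inj eq [symmetric] m conjunct1 [OF \<phi>_sum]])
    moreover have "?r \<in> {..<2} \<rightarrow>\<^sub>E carrier ps_ring"
      by (simp add: ps_ring_def)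
    ultimately show "\<exists>r. r \<in> {..<2} \<rightarrow>\<^sub>E carrier ps_ring \<and> m = (\<Oplus>\<^bsub>?M\<^esub>i\<in>{..<2}. r i \<odot>\<^bsub>?M\<^esub> b i)"
      by blast
  next
    fix r s
    assume r: "r \<in> {..<2} \<rightarrow>\<^sub>E carrier ps_ring \<and> m = (\<Oplus>\<^bsub>?M\<^esub>i\<in>{..<2}. r i \<odot>\<^bsub>?M\<^esub> b i)"
      and s: "s \<in> {..<2} \<rightarrow>\<^sub>E carrier ps_ring \<and> m = (\<Oplus>\<^bsub>?M\<^esub>i\<in>{..<2}. s i \<odot>\<^bsub>?M\<^esub> b i)"
    have "((r 0 - s 0) oo fps_X ^ 2) + fps_X ^ 1 * ((r 1 - s 1) oo fps_X ^ 2) = 0"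
      using \<phi>_sum [of r] \<phi>_sum [of s] r s by (simp add: fps_compose_sub_distrib algebra_simps)
    then have "r 0 - s 0 = 0" "r 1 - s 1 = 0"
      by (rule fps_even_odd_eq_0; simp)+
    then show "r = s"
      using r s by (intro PiE_ext [of r "{..<2}" _ s]) (auto simp: less_2_cases_iff)
  qed
  have "b \<in> {..<2} \<rightarrow> carrier ?M"
    using b by simp
  then show ?thesis
    unfolding free_of_rank_def by (intro conjI M.module_axioms bexI [of _ b] ballI unique)
qed

section \<open>The ideal \<open>P\<close> and the radical of \<open>PS\<close>\<close>

lemma cusp_param_hom_ring:
  "ring_hom_ring (ps_ring :: 'a::field fps fps ring) ring_of_type_algebra cusp_param"
  by (rule ring_hom_ringI) (simp_all add: ps_ring_def ring_type_algebra cusp_param_add cusp_param_mult)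

lemma a_kernel_cusp_param:
  "a_kernel (ps_ring :: 'a::field fps fps ring) ring_of_type_algebra cusp_param = cusp_ideal 2"
  unfolding cusp_ideal_def a_kernel_def' ps_ring_def PIdl_type_algebra
  by (simp add: cusp_param_eq_0_iff)

lemma primeideal_cusp_ideal: "primeideal (cusp_ideal 2) (ps_ring :: 'a::field fps fps ring)"
proof -
  interpret K: domain "ring_of_type_algebra :: 'a fps ring"
    by (rule domain_type_algebra)
  have "primeideal {f \<in> carrier ps_ring. cusp_param f \<in> {\<zero>\<^bsub>ring_of_type_algebra :: 'a fps ring\<^esub>}} ps_ring"
    by (rule ring_hom_ring.primeideal_vimage [OF cusp_param_hom_ring])
      (simp_all add: ps_ring_def cring_type_algebra K.zeroprimeideal [simplified])
  then show ?thesis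
    by (simp add: a_kernel_cusp_param [symmetric] a_kernel_def')
qed

text \<open>The first isomorphism theorem in the form that \<open>power_series_subring\<close> asks
  for: an embedding with known image.\<close>

lemma (in ring_hom_ring) FactRing_inj_hom:
  defines "\<eta> \<equiv> (\<lambda>C. the_elem (h ` C))"
  shows "\<eta> \<in> ring_hom (R Quot a_kernel R S h) S"
    "inj_on \<eta> (carrier (R Quot a_kernel R S h))"
    "\<eta> ` carrier (R Quot a_kernel R S h) = h ` carrier R"
  using the_elem_hom the_elem_inj the_elem_surj unfolding \<eta>_def inj_on_def by auto

text \<open>The radical is recognized as the kernel of a map from S onto k[[t]], so the quotient
  satisfies the surjectivity criterion for regularity.\<close>

lemma regular_quotient_radical:
  fixes PS :: "'k::field fps fps poly set set"
  assumes char: "CHAR('k) = 2" and PS: "PS = Idl\<^bsub>ext_ring 2\<^esub> (ext_hom 2 ` cusp_ideal 2)"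
  shows "regular_local_ring (ext_ring 2 Quot ideal_radical (ext_ring 2) PS)"
proof -
  let ?S = "ext_ring 2 :: 'k fps fps poly set ring"
  let ?K = "ring_of_type_algebra :: 'k fps ring"
  obtain \<phi> where \<phi>: "\<phi> \<in> ring_iso ?S ps_ring"
    "\<phi> (ext_t 2) = fps_X" "\<And>f. \<phi> (ext_hom 2 f) = f oo fps_X ^ 2"
    using ext_ring_iso by blast
  interpret S: cring ?S
    by (rule cring_ext_ring)
  define \<theta> where "\<theta> = subst_cube \<circ> \<phi>"
  have "subst_cube \<in> ring_hom ps_ring ?K"
    by (rule ring_hom_memI) (simp_all add: ps_ring_def subst_cube_add subst_cube_mult)
  then have "\<theta> \<in> ring_hom ?S ?K"
    unfolding \<theta>_def using \<phi>(1) by (intro ring_hom_trans) (simp_all add: ring_iso_def)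
  then interpret \<theta>: ring_hom_ring ?S ?K \<theta>
    by (intro ring_hom_ringI2 S.ring_axioms ring_type_algebra)
  have kernel: "c \<in> a_kernel ?S ?K \<theta> \<longleftrightarrow> c \<in> carrier ?S \<and> subst_cube (\<phi> c) = 0" for c
    by (simp only: a_kernel_def' mem_Collect_eq \<theta>_def comp_apply ring_of_type_algebra_simps)
  have bij: "bij_betw \<phi> (carrier ?S) UNIV"
    using \<phi>(1) by (simp add: ring_iso_def ps_ring_def)
  have \<phi>_mult: "\<phi> (a \<otimes>\<^bsub>?S\<^esub> b) = \<phi> a * \<phi> b" if "a \<in> carrier ?S" "b \<in> carrier ?S" for a b
    using \<phi>(1) that by (auto simp: ring_iso_def ps_ring_def dest: ring_hom_mult)
  have hom_closed: "ext_hom 2 f \<in> carrier ?S" for f :: "'k fps fps"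
    using ring_hom_closed [OF ext_hom_ring_hom, of f] by (simp add: ps_ring_def)
  have sub: "ext_hom 2 ` cusp_ideal 2 \<subseteq> carrier ?S"
    using hom_closed by blast
  have "range subst_cube = (UNIV :: 'k fps set)"
    using subst_cube_map_const by (metis surjI)
  then have surj: "\<theta> ` carrier ?S = UNIV"
    using bij unfolding \<theta>_def image_comp [symmetric] bij_betw_def by simp
  have two: "(2 :: 'k fps fps) = 0"
  proof -
    have "(2::'k) = 0"
      using of_nat_CHAR [where ?'a = 'k] char by simp
    then show ?thesis
      by (metis fps_const_0_eq_0 fps_numeral_fps_const)
  qed
  have "ideal_radical ?S PS = a_kernel ?S ?K \<theta>"
  proof (intro equalityI subsetI)
    fix a
    assume "a \<in> ideal_radical ?S PS"
    then obtain n where a: "a \<in> carrier ?S" "a [^]\<^bsub>?S\<^esub> (n::nat) \<in> PS"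
      unfolding ideal_radical_def by blast
    \<comment> \<open>As k[[t]] has no nilpotents, it is enough that the kernel contains PS.\<close>
    have "PS \<subseteq> a_kernel ?S ?K \<theta>"
      unfolding PS
    proof (rule S.genideal_minimal [OF \<theta>.kernel_is_ideal], rule subsetI)
      fix c
      assume "c \<in> ext_hom 2 ` (cusp_ideal 2 :: 'k fps fps set)"
      then obtain f where f: "c = ext_hom 2 f" "f \<in> cusp_ideal 2"
        by blast
      then have "cusp_param f = 0"
        using a_kernel_cusp_param [where ?'a = 'k] by (auto simp: a_kernel_def')
      then show "c \<in> a_kernel ?S ?K \<theta>"
        by (simp only: kernel \<phi>(3) f(1) hom_closed cusp_param_def)
    qed
    then have "a [^]\<^bsub>?S\<^esub> n \<in> a_kernel ?S ?K \<theta>"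
      using a(2) by (rule subsetD)
    then have "\<theta> (a [^]\<^bsub>?S\<^esub> n) = \<zero>\<^bsub>?K\<^esub>"
      by (rule \<theta>.kernel_zero)
    then have "\<theta> a ^ n = 0"
      unfolding \<theta>.hom_nat_pow [OF a(1)] by simp
    then have "subst_cube (\<phi> a) = 0"
      by (simp add: \<theta>_def)
    with a(1) show "a \<in> a_kernel ?S ?K \<theta>"
      unfolding kernel ..
  next
    fix a
    assume "a \<in> a_kernel ?S ?K \<theta>"
    then have a: "a \<in> carrier ?S" "subst_cube (\<phi> a) = 0"
      unfolding kernel by simp_all
    obtain q where q: "\<phi> a = (ps_y - ps_x ^ 3) * q"
      using a(2) unfolding subst_cube_eq_0_iff by (rule dvdE)
    \<comment> \<open>The square of (y - t^3) q is the image of the generator of P times q^2, so q^2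
      has to be pulled back to S.\<close>
    have "q ^ 2 \<in> \<phi> ` carrier ?S"
      using bij by (simp add: bij_betw_def)
    then obtain b where b: "\<phi> b = q ^ 2" "b \<in> carrier ?S"
      by (metis imageE)
    let ?g = "ps_y ^ 2 - ps_x ^ 3 :: 'k fps fps"
    \<comment> \<open>Characteristic 2 merges the two factors of y^2 - t^6.\<close>
    have "ps_y + ps_x ^ 3 = ps_y - (ps_x ^ 3 :: 'k fps fps)"
      using two by (simp add: eq_diff_eq add.assoc flip: mult_2)
    then have eq: "\<phi> a * \<phi> a = (?g oo fps_X ^ 2) * \<phi> b"
      unfolding q b(1) ps_y_square_minus_ps_x_cube_compose by (simp add: power2_eq_square mult_ac)
    have aa: "a [^]\<^bsub>?S\<^esub> (2::nat) = a \<otimes>\<^bsub>?S\<^esub> a"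
      using a(1) S.nat_pow_mult [of a 1 1] by (metis S.nat_pow_eone one_add_one)
    have "\<phi> (a \<otimes>\<^bsub>?S\<^esub> a) = \<phi> (ext_hom 2 ?g \<otimes>\<^bsub>?S\<^esub> b)"
      using eq by (simp only: \<phi>_mult \<phi>(3) a(1) b(2) hom_closed)
    then have "a \<otimes>\<^bsub>?S\<^esub> a = ext_hom 2 ?g \<otimes>\<^bsub>?S\<^esub> b"
      by (rule inj_onD [OF bij_betw_imp_inj_on [OF bij]]) (intro S.m_closed a(1) b(2) hom_closed)+
    moreover have "ext_hom 2 ?g \<in> PS"
    proof -
      have "?g \<in> cusp_ideal 2"
        unfolding cusp_ideal_def ps_ring_def PIdl_type_algebra by simp
      then show ?thesis
        unfolding PS using S.genideal_self [OF sub] by blast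
    qed
    moreover have "ideal PS ?S"
      unfolding PS by (rule S.genideal_ideal [OF sub])
    ultimately have "a [^]\<^bsub>?S\<^esub> (2::nat) \<in> PS"
      using b(2) by (simp only: aa ideal.I_r_closed)
    then show "a \<in> ideal_radical ?S PS"
      unfolding ideal_radical_def using a(1) by (intro CollectI conjI exI)
  qed
  moreover have "regular_local_ring (?S Quot a_kernel ?S ?K \<theta>)"
  proof -
    interpret B: cring "?S Quot a_kernel ?S ?K \<theta>"
      by (rule ideal.quotient_is_cring [OF \<theta>.kernel_is_ideal S.cring_axioms])
    interpret power_series_subring "?S Quot a_kernel ?S ?K \<theta>" "\<lambda>C. the_elem (\<theta> ` C)"
      using \<theta>.FactRing_inj_hom surj by unfold_locales auto
    show ?thesis
      using \<theta>.FactRing_inj_hom(3) surj by (intro regular_local_ring_if_surj) simp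
  qed
  ultimately show ?thesis
    by simp
qed

lemma cusp_ring_quotient:
  assumes "CHAR('k::field) = 2"
  shows "cusp_ring (ps_ring Quot cusp_ideal 2) (\<lambda>C. the_elem (cusp_param ` C) :: 'k fps)"
proof -
  interpret \<psi>: ring_hom_ring "ps_ring :: 'k fps fps ring" ring_of_type_algebra cusp_param
    by (rule cusp_param_hom_ring)
  interpret P: primeideal "cusp_ideal 2 :: 'k fps fps set" ps_ring
    by (rule primeideal_cusp_ideal)
  interpret B: cring "ps_ring Quot (cusp_ideal 2 :: 'k fps fps set)"
    by (rule P.quotient_is_cring) (simp add: ps_ring_def cring_type_algebra)
  note \<eta> = \<psi>.FactRing_inj_hom [unfolded a_kernel_cusp_param]
  have image: "(\<lambda>C. the_elem (cusp_param ` C)) ` carrier (ps_ring Quot (cusp_ideal 2 :: 'k fps fps set)) =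
    {f :: 'k fps. f $ 1 = 0}"
    using \<eta>(3) by (simp add: ps_ring_def range_cusp_param)
  show ?thesis
  proof
    show "(2::'k) = 0"
      using of_nat_CHAR [where ?'a = 'k] assms by simp
    fix b
    assume b: "b \<in> carrier (ps_ring Quot (cusp_ideal 2 :: 'k fps fps set))"
      "the_elem (cusp_param ` b) $ 0 \<noteq> 0"
    then have "the_elem (cusp_param ` b) $ 1 = 0"
      using image by blast
    \<comment> \<open>The linear coefficient of 1/f is -f_1/f_0^2, so it vanishes with f_1.\<close>
    then have "inverse (the_elem (cusp_param ` b)) $ 1 = 0"
      by (simp add: fps_inverse_def)
    then show "inverse (the_elem (cusp_param ` b))
        \<in> (\<lambda>C. the_elem (cusp_param ` C)) ` carrier (ps_ring Quot cusp_ideal 2)"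
      unfolding image by simp
  qed (use \<eta>(1,2) image in auto)
qed

theorem theorem3p6:
  fixes p :: nat
    and R :: "'k::field fps fps ring"
    and S :: "'k fps fps poly set ring"
    and P :: "'k fps fps set"
    and PS :: "'k fps fps poly set set"
  assumes "perfect_field TYPE('k)"
    and "CHAR('k) = p"
    and "p = 2"
    and "R = ps_ring"
    and "S = ext_ring p"
    and "P = cusp_ideal p"
    and "PS = Idl\<^bsub>S\<^esub> (ext_hom p ` P)"
  shows "(\<exists>\<phi> \<in> ring_iso S (ps_ring :: 'k fps fps ring).
            \<phi> (ext_t p) = fps_X \<and> (\<forall>f. \<phi> (ext_hom p f) = f oo fps_X ^ p))
    \<and> free_of_rank R (module_along (ext_hom p) S) p
    \<and> primeideal P R
    \<and> regular_local_ring (S Quot ideal_radical S PS)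
    \<and> \<not> F_pure p (R Quot P)
    \<and> \<not> F_injective p (R Quot P)
    \<and> \<not> F_rational p (R Quot P)"
proof -
  have char: "CHAR('k) = 2"
    using assms by simp
  interpret cusp_ring "ps_ring Quot cusp_ideal 2" "\<lambda>C. the_elem (cusp_param ` C) :: 'k fps"
    by (rule cusp_ring_quotient [OF char])
  have "fps_X \<notin> (\<lambda>C. the_elem (cusp_param ` C) :: 'k fps) ` carrier (ps_ring Quot cusp_ideal 2)"
    by (simp add: image_h)
  then have "\<not> F_rational 2 (ps_ring Quot (cusp_ideal 2 :: 'k fps fps set))"
    by (rule not_F_rational)
  then show ?thesis
    unfolding assms(3-7)
    using ext_ring_iso free_ext_ring primeideal_cusp_ideal regular_quotient_radical [OF char refl] not_F_pure not_F_injective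
    by blast
qed

end
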